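(* Let $A\in\mathbb{R}^{n\times n}$ be a symmetric positive semi-definite matrix, and let $x:\mathbb{R}_+\to\mathbb{R}^n$ be an arbitrary absolutely continuous function (so that $\dot x(t)$ exists for almost every $t$). Suppose that for every $i=1,\dots,n$ and almost every $t\ge 0$, $$\dot x_i(t)\, A_{i,:}\,x(t)\le 0,$$ where $A_{i,:}$ denotes the $i$th row of $A$. Then: (a) If $A$ is positive definite, then $x(t)$ converges, as $t\to\infty$, to a constant vector $x^*\in\mathbb{R}^n$. (b) If $A$ is positive semi-definite and no nonzero vector of its kernel has a zero component (i.e. $w\in\ker A$, $w\ne 0$ implies $w_i\neq 0$ for all $i$), then either $x(t)$ converges, as $t\to\infty$, to a constant vector $x^*\in\mathbb{R}^n$, or every accumulation point $\bar x$ of $x(t)$ lies in $\ker A$.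
   Context: $\mathbb{R}_+=[0,\infty)$. For a vector $v$, $v_i$ denotes its $i$th entry. "Absolutely continuous" on $\mathbb{R}_+$ means absolutely continuous on every compact subinterval of $\mathbb{R}_+$. An accumulation point of $x(t)$ is a point $\bar x\in\mathbb{R}^n$ for which there is a sequence $t_m\to\infty$ with $x(t_m)\to\bar x$. The existence of an accumulation point is not asserted in (b). *)

theory Defs
  imports "HOL-Analysis.Analysis"
begin

definition pos_semidef_matrix :: "real^'n^'n \<Rightarrow> bool" where
  "pos_semidef_matrix A \<longleftrightarrow> transpose A = A \<and> (\<forall>v. 0 \<le> v \<bullet> (A *v v))"

definition pos_def_matrix :: "real^'n^'n \<Rightarrow> bool" where
  "pos_def_matrix A \<longleftrightarrow> transpose A = A \<and> (\<forall>v. v \<noteq> 0 \<longrightarrow> 0 < v \<bullet> (A *v v))"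

definition matrix_kernel :: "real^'n^'m \<Rightarrow> (real^'n) set" where
  "matrix_kernel A = {w. A *v w = 0}"

text \<open>
  The usual \<open>\<epsilon>\<close>-\<open>\<delta>\<close> notion: a finite family of non-overlapping compact intervals
  inside \<open>S\<close> is a division \<open>d\<close> of its union \<open>T\<close>. For an interval \<open>k = {u..v}\<close> in \<open>d\<close>,
  \<open>Inf k = u\<close> and \<open>Sup k = v\<close>. (The library constant
  \<open>absolutely_continuous\<close> is about measures.)
\<close>

definition absolutely_continuous_fun_on ::
  "real set \<Rightarrow> (real \<Rightarrow> 'a::real_normed_vector) \<Rightarrow> bool" where
  "absolutely_continuous_fun_on S f \<longleftrightarrow>
     (\<forall>\<epsilon>>0. \<exists>\<delta>>0. \<forall>d T. d division_of T \<and> T \<subseteq> S \<and> (\<Sum>k\<in>d. Sup k - Inf k) < \<delta>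
        \<longrightarrow> (\<Sum>k\<in>d. norm (f (Sup k) - f (Inf k))) < \<epsilon>)"

definition locally_absolutely_continuous_fun_on ::
  "real set \<Rightarrow> (real \<Rightarrow> 'a::real_normed_vector) \<Rightarrow> bool" where
  "locally_absolutely_continuous_fun_on S f \<longleftrightarrow>
     (\<forall>a b. {a..b} \<subseteq> S \<longrightarrow> absolutely_continuous_fun_on {a..b} f)"

text \<open>
  Accumulation points, for \<open>t \<rightarrow> \<infinity>\<close>, of a function on \<open>[0,\<infinity>)\<close>. Values at negative
  arguments are irrelevant.
\<close>

definition accumulation_point_at_top ::
  "(real \<Rightarrow> 'a::topological_space) \<Rightarrow> 'a \<Rightarrow> bool" where
  "accumulation_point_at_top x p \<longleftrightarrow>
     (\<exists>s :: nat \<Rightarrow> real. (\<forall>m. 0 \<le> s m) \<and> filterlim s at_top sequentially \<and>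
        (\<lambda>m. x (s m)) \<longlonglongrightarrow> p)"

end

theory Submission
  imports Defs
begin

text \<open>
  The energy \<open>V(x) = (x \<bullet> A x)/2\<close> of the trajectory has derivative \<open>\<Sum>\<^sub>i x'\<^sub>i (A x)\<^sub>i\<close>, a sum of nonpositive
  terms, so it decreases. Moreover, as long as \<open>|(A x)\<^sub>i| \<ge> c > 0\<close>, the component \<open>x\<^sub>i\<close> cannot move by more
  than \<open>1/c\<close> times the energy lost (\<open>displacement_le_energy_loss\<close>).

  Let \<open>p\<close> be an accumulation point. If the trajectory does not converge to \<open>p\<close>, it travels again and
  again from near \<open>p\<close> to a small sphere around \<open>p\<close>, and the energy lost on the way tends to zero. So some
  point \<open>y = p + d\<close> of the sphere has the same energy as \<open>p\<close>, and \<open>d\<^sub>i = 0\<close> whenever \<open>(A p)\<^sub>i \<noteq> 0\<close>. Expanding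
  \<open>V(p + d) = V(p)\<close>, the linear term \<open>d \<bullet> A p\<close> vanishes, hence \<open>d \<bullet> A d = 0\<close> and, as \<open>A\<close> is positive
  semi-definite, \<open>A d = 0\<close>. Thus a nonzero kernel vector vanishes wherever \<open>A p\<close> does not
  (\<open>tendsto_accumulation_point\<close>). If \<open>A\<close> is positive definite there is no such vector, and an accumulation
  point exists because the energy bounds the norm. If nonzero kernel vectors have no zero component,
  there is no such vector unless \<open>A p = 0\<close>. These are the two claims.

  The analytic foundation is that an absolutely continuous function does not increase if its derivative is
  nonpositive almost everywhere (\<open>absolutely_continuous_antimono\<close>), together with the fact that it
  has a derivative almost everywhere (\<open>absolutely_continuous_ae_differentiable\<close>): at a point without
  a derivative, \<open>vector_derivative\<close> is an unspecified value, and the hypothesis says nothing. Both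
  follow from the Vitali covering theorem: intervals over which the function has a prescribed slope
  can be packed so densely that absolute continuity makes the gaps irrelevant.
\<close>

section \<open>Increments over interval packings\<close>

definition increment :: "(real \<Rightarrow> real) \<Rightarrow> real set \<Rightarrow> real" where
  "increment f K = f (Sup K) - f (Inf K)"

definition interval_packing :: "real set set \<Rightarrow> bool" where
  "interval_packing D \<longleftrightarrow> finite D \<and> disjoint D \<and> (\<forall>K\<in>D. \<exists>u v. u < v \<and> K = {u..v})"

lemma increment_atLeastAtMost [simp]: "u \<le> v \<Longrightarrow> increment f {u..v} = f v - f u"
  by (simp add: increment_def)

lemma interval_packingD:
  assumes "interval_packing D"
  shows "finite D" "disjoint D"
    and "\<And>K. K \<in> D \<Longrightarrow> \<exists>u v. u < v \<and> K = {u..v}"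
    and "\<And>K. K \<in> D \<Longrightarrow> measure lebesgue K = increment (\<lambda>t. t) K"
    and "\<And>K. K \<in> D \<Longrightarrow> K \<in> lmeasurable"
  using assms by (auto simp: interval_packing_def)

lemma interval_packing_subset:
  "interval_packing D \<Longrightarrow> D' \<subseteq> D \<Longrightarrow> interval_packing D'"
  unfolding interval_packing_def by (meson finite_subset pairwise_subset subsetD)

lemma interval_packing_division:
  assumes "interval_packing D"
  shows "D division_of \<Union>D"
proof -
  have "interior K \<inter> interior L = {}" if "K \<in> D" "L \<in> D" "K \<noteq> L" for K L
  proof -
    have "K \<inter> L = {}"
      using interval_packingD(2)[OF assms] that by (auto simp: pairwise_def disjnt_def)
    then show ?thesis
      using interior_subset[of K] interior_subset[of L] by blast
  qed
  moreover have "K \<noteq> {} \<and> (\<exists>a b. K = cbox a b)" if "K \<in> D" for K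
    using interval_packingD(3)[OF assms that] by force
  ultimately show ?thesis
    unfolding division_of_def using interval_packingD(1)[OF assms] by blast
qed

lemma measure_interval_packing:
  assumes "interval_packing D"
  shows "measure lebesgue (\<Union>D) = (\<Sum>K\<in>D. increment (\<lambda>t. t) K)"
proof -
  have "pairwise (\<lambda>S T. negligible (S \<inter> T)) D"
    using interval_packingD(2)[OF assms] by (auto simp: pairwise_def disjnt_def)
  then have "measure lebesgue (\<Union>D) = (\<Sum>K\<in>D. measure lebesgue K)"
    using interval_packingD(1,5)[OF assms] by (intro measure_negligible_finite_Union) auto
  then show ?thesis
    using interval_packingD(4)[OF assms] by simp
qed

lemma interval_packing_Union_lmeasurable:
  "interval_packing D \<Longrightarrow> \<Union>D \<in> lmeasurable"
  using interval_packingD(1,5) by (auto intro: fmeasurable.finite_Union)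

lemma sum_increment_division:
  assumes "d division_of {a..b}" "a \<le> b"
  shows "(\<Sum>K\<in>d. increment f K) = f b - f a"
proof -
  have cl: "Inf K \<in> K" if "K \<in> d" for K
    using division_ofD(3,4)[OF assms(1) that] by fastforce
  have "(\<lambda>K. (Inf K, K)) ` d tagged_division_of {a..b}"
  proof (rule tagged_division_ofI)
    show "\<Union>{K. \<exists>x. (x, K) \<in> (\<lambda>K. (Inf K, K)) ` d} = {a..b}"
      unfolding division_ofD(6)[OF assms(1), symmetric] by auto
  next
    fix x1 K1 x2 K2
    assume "(x1, K1) \<in> (\<lambda>K. (Inf K, K)) ` d" "(x2, K2) \<in> (\<lambda>K. (Inf K, K)) ` d"
      "(x1, K1) \<noteq> (x2, K2)"
    then show "interior K1 \<inter> interior K2 = {}"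
      using division_ofD(5)[OF assms(1)] by auto
  qed (use division_ofD(1,2,4)[OF assms(1)] cl in auto)
  then have "(\<Sum>(x, K)\<in>(\<lambda>K. (Inf K, K)) ` d. f (Sup K) - f (Inf K)) = f b - f a"
    by (rule additive_tagged_division_1[OF assms(2)])
  then show ?thesis
    by (simp add: sum.reindex inj_on_def increment_def)
qed

text \<open>
  The gaps that a packing \<open>C\<close> leaves inside a coarser packing \<open>D\<close> form a division again. Hence
  absolute continuity bounds the difference of the two sums of increments as soon as the two unions
  differ by little measure; that is how two packings with opposite slopes are compared below.
\<close>

lemma packing_remainder:
  assumes D: "interval_packing D" and C: "interval_packing C"
    and sub: "\<And>J. J \<in> C \<Longrightarrow> \<exists>K\<in>D. J \<subseteq> K"
  obtains r where "r division_of \<Union>r" "\<Union>r \<subseteq> \<Union>D"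
    "\<And>f. (\<Sum>K\<in>r. increment f K) = (\<Sum>K\<in>D. increment f K) - (\<Sum>J\<in>C. increment f J)"
proof -
  define CI where "CI K = {J\<in>C. J \<subseteq> K}" for K
  have "\<exists>q. CI K \<subseteq> q \<and> q division_of K" if K: "K \<in> D" for K
  proof -
    obtain u v where uv: "u < v" "K = {u..v}"
      using interval_packingD(3)[OF D K] by blast
    have "interval_packing (CI K)"
      using interval_packing_subset[OF C] by (auto simp: CI_def)
    from interval_packing_division[OF this]
    obtain q where "CI K \<subseteq> q" "q division_of cbox u v"
      by (rule partial_division_extend_interval) (auto simp: CI_def uv)
    then show ?thesis using uv by auto
  qed
  then obtain q where q: "\<And>K. K \<in> D \<Longrightarrow> CI K \<subseteq> q K" "\<And>K. K \<in> D \<Longrightarrow> q K division_of K"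
    by metis
  define r where "r = (\<Union>K\<in>D. q K - CI K)"
  have finq: "finite (q K)" if "K \<in> D" for K using q(2)[OF that] by auto
  have disjD: "K \<inter> L = {}" if "K \<in> D" "L \<in> D" "K \<noteq> L" for K L
    using interval_packingD(2)[OF D] that by (auto simp: pairwise_def disjnt_def)
  have qD: "J \<subseteq> K" "J \<noteq> {}" "\<exists>a b. J = cbox a b" if "K \<in> D" "J \<in> q K" for J K
    using division_ofD[OF q(2)[OF that(1)]] that by auto
  have disjq: "q K \<inter> q L = {}" if "K \<in> D" "L \<in> D" "K \<noteq> L" for K L
    using disjD[OF that] qD(1,2) that by blast
  have divr: "r division_of \<Union>r"
    unfolding division_of_def
  proof (intro conjI ballI impI)
    show "finite r" using finq interval_packingD(1)[OF D] by (auto simp: r_def)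
    show "J \<subseteq> \<Union>r" "J \<noteq> {}" "\<exists>a b. J = cbox a b" if "J \<in> r" for J
      using that qD by (auto simp: r_def)
    show "interior J \<inter> interior L = {}" if "J \<in> r" "L \<in> r" and neq: "J \<noteq> L" for J L
    proof -
      obtain K K' where K: "K \<in> D" "J \<in> q K" and K': "K' \<in> D" "L \<in> q K'"
        using \<open>J \<in> r\<close> \<open>L \<in> r\<close> unfolding r_def by blast
      show ?thesis
      proof (cases "K = K'")
        case True
        then show ?thesis using division_ofD(5)[OF q(2)[OF K(1)]] K K' neq by blast
      next
        case False
        then show ?thesis
          using disjD[OF K(1) K'(1) False] qD(1)[OF K] qD(1)[OF K'] 
            interior_subset[of J] interior_subset[of L] by blast
      qed
    qed
  qed simp
  have "\<Union>r \<subseteq> \<Union>D"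
    using qD(1) by (fastforce simp: r_def)
  moreover have "(\<Sum>K\<in>r. increment f K) = (\<Sum>K\<in>D. increment f K) - (\<Sum>J\<in>C. increment f J)" for f
  proof -
    have CU: "C = (\<Union>K\<in>D. CI K)"
      using sub by (auto simp: CI_def)
    have "(\<Sum>J\<in>C. increment f J) = (\<Sum>K\<in>D. \<Sum>J\<in>CI K. increment f J)"
      unfolding CU
    proof (rule sum.UNION_disjoint)
      show "\<forall>K\<in>D. finite (CI K)" using q(1) finq finite_subset by metis
      show "\<forall>K\<in>D. \<forall>L\<in>D. K \<noteq> L \<longrightarrow> CI K \<inter> CI L = {}" using q(1) disjq by blast
    qed (use D in \<open>auto dest: interval_packingD\<close>)
    moreover have "(\<Sum>J\<in>r. increment f J) = (\<Sum>K\<in>D. \<Sum>J\<in>q K - CI K. increment f J)"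
      unfolding r_def
    proof (rule sum.UNION_disjoint)
      show "\<forall>K\<in>D. \<forall>L\<in>D. K \<noteq> L \<longrightarrow> (q K - CI K) \<inter> (q L - CI L) = {}" using disjq by blast
    qed (use finq D in \<open>auto dest: interval_packingD\<close>)
    moreover have "(\<Sum>J\<in>q K - CI K. increment f J) = increment f K - (\<Sum>J\<in>CI K. increment f J)"
      if K: "K \<in> D" for K
    proof -
      obtain u v where uv: "u < v" "K = {u..v}"
        using interval_packingD(3)[OF D K] by blast
      have "(\<Sum>J\<in>q K. increment f J) = increment f K"
        using sum_increment_division[of "q K" u v f] q(2)[OF K] uv by simp
      then show ?thesis
        using sum_diff[OF finq[OF K] q(1)[OF K], of "increment f"] by simp
    qed
    ultimately show ?thesis by (simp add: sum_subtractf)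
  qed
  ultimately show ?thesis using that divr by blast
qed

text \<open>
  A closed interval is a closed ball around its midpoint, so the Vitali covering theorem yields a
  countable disjoint subfamily that covers \<open>E\<close> up to a null set. Finitely many members are enough
  up to measure \<open>\<eta>\<close>, and finite families are what absolute continuity can be applied to.
\<close>

lemma vitali_interval_packing:
  fixes E :: "real set"
  assumes E: "E \<in> lmeasurable" and "0 < \<eta>"
    and fine: "\<And>t d. t \<in> E \<Longrightarrow> 0 < d \<Longrightarrow> \<exists>u v. u < v \<and> t \<in> {u..v} \<and> v - u < d \<and> P {u..v}"
  obtains D where "interval_packing D" "\<And>K. K \<in> D \<Longrightarrow> P K" "measure lebesgue (E - \<Union>D) < \<eta>"
proof -
  define I where "I = {(c, r). 0 < r \<and> P {c - r..c + r}}"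
  have ball: "cball (fst i) (snd i) = {fst i - snd i..fst i + snd i}" for i :: "real \<times> real"
    by (simp add: cball_eq_atLeastAtMost)
  have pos: "0 < snd i" if "i \<in> I" for i using that by (auto simp: I_def)
  have fineI: "\<exists>i. i \<in> I \<and> t \<in> cball (fst i) (snd i) \<and> snd i < d" if td: "t \<in> E" "0 < d" for t d
  proof -
    obtain u v where uv: "u < v" "t \<in> {u..v}" "v - u < d" "P {u..v}" using fine[OF td] by blast
    define i where "i = ((u + v) / 2, (v - u) / 2)"
    have "{fst i - snd i..fst i + snd i} = {u..v}"
      by (simp add: i_def field_simps)
    then have "i \<in> I" "t \<in> cball (fst i) (snd i)"
      using uv unfolding ball by (simp_all add: I_def i_def)
    moreover have "snd i < d" using uv by (simp add: i_def)
    ultimately show ?thesis by blast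
  qed
  obtain C where C: "countable C" "C \<subseteq> I"
    "pairwise (\<lambda>i j. disjnt (cball (fst i) (snd i)) (cball (fst j) (snd j))) C"
    "negligible (E - (\<Union>i\<in>C. cball (fst i) (snd i)))"
    using Vitali_covering_theorem_cballs[of I snd E fst, OF pos fineI] by blast
  define B where "B i = cball (fst i) (snd i)" for i :: "real \<times> real"
  have EB: "E \<inter> B i \<in> lmeasurable" for i
    using E by (auto simp: B_def intro: fmeasurable_Int_fmeasurable)
  obtain F where F: "F \<subseteq> (\<lambda>i. E \<inter> B i) ` C" "finite F"
    "measure lebesgue (\<Union>((\<lambda>i. E \<inter> B i) ` C)) - \<eta> < measure lebesgue (\<Union>F)"
  proof (rule measure_countable_Union_approachable[of "(\<lambda>i. E \<inter> B i) ` C" \<eta> "measure lebesgue E"])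
    show "countable ((\<lambda>i. E \<inter> B i) ` C)" using C(1) by simp
    show "measure lebesgue (\<Union>D') \<le> measure lebesgue E"
      if "D' \<subseteq> (\<lambda>i. E \<inter> B i) ` C" "finite D'" for D'
      using that E EB by (intro measure_mono_fmeasurable) (auto intro!: sets.finite_Union)
    show "X \<in> lmeasurable" if "X \<in> (\<lambda>i. E \<inter> B i) ` C" for X
      using that EB by blast
  qed (use \<open>0 < \<eta>\<close> in auto)
  obtain G where G: "G \<subseteq> C" "finite G" "F = (\<lambda>i. E \<inter> B i) ` G"
    using finite_subset_image[OF F(2,1)] by blast
  define D where "D = B ` G"
  have UE: "\<Union>((\<lambda>i. E \<inter> B i) ` C) \<in> lmeasurable"
  proof (rule fmeasurableI2[OF E])
    show "\<Union>((\<lambda>i. E \<inter> B i) ` C) \<in> sets lebesgue"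
      using C(1) EB[THEN fmeasurableD] by (intro sets.countable_UN'')
  qed blast
  have UF: "\<Union>F \<in> lmeasurable"
    using G(2) EB unfolding G(3) by (intro fmeasurable.finite_Union) auto
  have "measure lebesgue E = measure lebesgue (\<Union>((\<lambda>i. E \<inter> B i) ` C))"
  proof (rule measure_negligible_symdiff[OF UE])
    have "(\<Union>((\<lambda>i. E \<inter> B i) ` C) - E) \<union> (E - \<Union>((\<lambda>i. E \<inter> B i) ` C)) = E - (\<Union>i\<in>C. B i)" by auto
    then show "negligible ((\<Union>((\<lambda>i. E \<inter> B i) ` C) - E) \<union> (E - \<Union>((\<lambda>i. E \<inter> B i) ` C)))"
      using C(4) by (simp add: B_def)
  qed
  moreover have "measure lebesgue (E - \<Union>D) = measure lebesgue E - measure lebesgue (\<Union>F)"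
  proof -
    have "E - \<Union>D = E - \<Union>F" by (auto simp: D_def G)
    moreover have "\<Union>F \<subseteq> E" by (auto simp: G)
    ultimately show ?thesis using measurable_measure_Diff[OF E, of "\<Union>F"] UF by (simp add: fmeasurableD)
  qed
  ultimately have small: "measure lebesgue (E - \<Union>D) < \<eta>" using F(3) by simp
  have "interval_packing D"
    unfolding interval_packing_def
  proof (intro conjI ballI)
    show "finite D" using G by (simp add: D_def)
    show "disjoint D"
    proof (rule pairwiseI)
      fix K L assume KL: "K \<in> D" "L \<in> D" "K \<noteq> L"
      obtain i where i: "i \<in> G" "K = B i" using KL(1) unfolding D_def by (rule imageE)
      obtain j where j: "j \<in> G" "L = B j" using KL(2) unfolding D_def by (rule imageE)
      have "i \<noteq> j" using KL(3) i(2) j(2) by blast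
      then show "disjnt K L"
        using pairwiseD[OF C(3) subsetD[OF G(1) i(1)] subsetD[OF G(1) j(1)]]
        by (simp add: B_def i(2) j(2))
    qed
    show "\<exists>u v. u < v \<and> K = {u..v}" if K: "K \<in> D" for K
    proof -
      obtain i where i: "i \<in> G" "K = B i" using K by (auto simp: D_def)
      then have "0 < snd i" using G C(2) pos by blast
      moreover have "K = {fst i - snd i..fst i + snd i}" using i(2) by (simp only: B_def ball)
      ultimately show ?thesis by (intro exI[of _ "fst i - snd i"] exI[of _ "fst i + snd i"]) simp
    qed
  qed
  moreover have "P K" if "K \<in> D" for K
  proof -
    obtain i where "i \<in> G" "K = B i" using \<open>K \<in> D\<close> unfolding D_def by (rule imageE)
    moreover from this have "i \<in> I" using G(1) C(2) by blast
    ultimately show ?thesis by (auto simp: I_def B_def ball simp del: mem_cball)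
  qed
  ultimately show ?thesis using that small by blast
qed

section \<open>Absolutely continuous functions\<close>

lemma Inf_Sup_in_division:
  fixes d :: "real set set"
  assumes "d division_of T" "K \<in> d"
  shows "Inf K \<in> K" "Sup K \<in> K"
  using division_ofD(3,4)[OF assms] by fastforce+

lemma absolutely_continuous_fun_on_real:
  fixes f :: "real \<Rightarrow> real"
  assumes "absolutely_continuous_fun_on S f" "0 < \<epsilon>"
  shows "\<exists>\<delta>>0. \<forall>r. r division_of \<Union>r \<and> \<Union>r \<subseteq> S \<and> (\<Sum>K\<in>r. increment (\<lambda>t. t) K) < \<delta>
      \<longrightarrow> \<bar>\<Sum>K\<in>r. increment f K\<bar> < \<epsilon>"
proof -
  obtain \<delta> where \<delta>: "0 < \<delta>" "\<And>d T. d division_of T \<and> T \<subseteq> S \<and> (\<Sum>k\<in>d. Sup k - Inf k) < \<delta>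
        \<Longrightarrow> (\<Sum>k\<in>d. norm (f (Sup k) - f (Inf k))) < \<epsilon>"
    using assms unfolding absolutely_continuous_fun_on_def by meson
  show ?thesis
  proof (intro exI conjI allI impI)
    fix r assume "r division_of \<Union>r \<and> \<Union>r \<subseteq> S \<and> (\<Sum>K\<in>r. increment (\<lambda>t. t) K) < \<delta>"
    then have "(\<Sum>k\<in>r. norm (f (Sup k) - f (Inf k))) < \<epsilon>"
      using \<delta>(2)[of r "\<Union>r"] by (simp add: increment_def)
    then show "\<bar>\<Sum>K\<in>r. increment f K\<bar> < \<epsilon>"
      using sum_abs[of "increment f" r] unfolding increment_def real_norm_def by (rule le_less_trans[rotated])
  qed (rule \<delta>(1))
qed

lemma absolutely_continuous_fun_on_imp_continuous_on:
  fixes f :: "real \<Rightarrow> 'a::real_normed_vector"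
  assumes f: "absolutely_continuous_fun_on {a..b} f"
  shows "continuous_on {a..b} f"
  unfolding continuous_on_iff
proof (intro ballI allI impI)
  fix t \<epsilon> :: real assume t: "t \<in> {a..b}" and "0 < \<epsilon>"
  then obtain \<delta> where \<delta>: "0 < \<delta>" "\<And>d T. d division_of T \<and> T \<subseteq> {a..b} \<and> (\<Sum>k\<in>d. Sup k - Inf k) < \<delta>
        \<Longrightarrow> (\<Sum>k\<in>d. norm (f (Sup k) - f (Inf k))) < \<epsilon>"
    using f unfolding absolutely_continuous_fun_on_def by meson
  have "dist (f s) (f t) < \<epsilon>" if s: "s \<in> {a..b}" "dist s t < \<delta>" for s
  proof -
    define u v where "u = min s t" and "v = max s t"
    have uv: "u \<le> v" "{u..v} \<subseteq> {a..b}" "v - u < \<delta>"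
      using s t by (auto simp: u_def v_def dist_real_def)
    then have "{{u..v}} division_of {u..v}"
      using division_of_self[of u v] by simp
    from \<delta>(2)[of "{{u..v}}" "{u..v}"] this uv have "norm (f v - f u) < \<epsilon>"
      by simp
    then show ?thesis
      by (auto simp: u_def v_def dist_norm norm_minus_commute min_def max_def split: if_splits)
  qed
  then show "\<exists>d>0. \<forall>s\<in>{a..b}. dist s t < d \<longrightarrow> dist (f s) (f t) < \<epsilon>"
    using \<delta>(1) by blast
qed

text \<open>
  Applied to \<open>g = F \<circ> f\<close> with \<open>F\<close> Lipschitz on the range of \<open>f\<close>: this covers negation, components,
  and a quadratic form along a bounded trajectory.
\<close>

lemma absolutely_continuous_fun_on_dominated:
  fixes f :: "real \<Rightarrow> 'a::real_normed_vector" and g :: "real \<Rightarrow> 'b::real_normed_vector"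
  assumes f: "absolutely_continuous_fun_on S f"
    and dom: "\<And>s t. s \<in> S \<Longrightarrow> t \<in> S \<Longrightarrow> norm (g s - g t) \<le> C * norm (f s - f t)"
  shows "absolutely_continuous_fun_on S g"
  unfolding absolutely_continuous_fun_on_def
proof (intro allI impI)
  fix \<epsilon> :: real assume "0 < \<epsilon>"
  then have "0 < \<epsilon> / (\<bar>C\<bar> + 1)" by simp
  then obtain \<delta> where \<delta>: "0 < \<delta>" "\<And>d T. d division_of T \<and> T \<subseteq> S \<and> (\<Sum>k\<in>d. Sup k - Inf k) < \<delta>
        \<Longrightarrow> (\<Sum>k\<in>d. norm (f (Sup k) - f (Inf k))) < \<epsilon> / (\<bar>C\<bar> + 1)"
    using f unfolding absolutely_continuous_fun_on_def by meson
  show "\<exists>\<delta>>0. \<forall>d T. d division_of T \<and> T \<subseteq> S \<and> (\<Sum>k\<in>d. Sup k - Inf k) < \<delta>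
        \<longrightarrow> (\<Sum>k\<in>d. norm (g (Sup k) - g (Inf k))) < \<epsilon>"
  proof (intro exI[of _ \<delta>] conjI allI impI \<delta>(1))
    fix d T assume d: "d division_of T \<and> T \<subseteq> S \<and> (\<Sum>k\<in>d. Sup k - Inf k) < \<delta>"
    have "norm (g (Sup k) - g (Inf k)) \<le> (\<bar>C\<bar> + 1) * norm (f (Sup k) - f (Inf k))" if "k \<in> d" for k
    proof -
      have "Sup k \<in> S" "Inf k \<in> S"
        using Inf_Sup_in_division[of d T k] division_ofD(2)[of d T k] d that by blast+
      then have "norm (g (Sup k) - g (Inf k)) \<le> C * norm (f (Sup k) - f (Inf k))"
        by (rule dom)
      also have "\<dots> \<le> (\<bar>C\<bar> + 1) * norm (f (Sup k) - f (Inf k))"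
        by (intro mult_right_mono) auto
      finally show ?thesis .
    qed
    then have "(\<Sum>k\<in>d. norm (g (Sup k) - g (Inf k)))
        \<le> (\<bar>C\<bar> + 1) * (\<Sum>k\<in>d. norm (f (Sup k) - f (Inf k)))"
      unfolding sum_distrib_left by (rule sum_mono)
    also have "\<dots> < (\<bar>C\<bar> + 1) * (\<epsilon> / (\<bar>C\<bar> + 1))"
      using \<delta>(2)[OF d] by (intro mult_strict_left_mono) auto
    finally show "(\<Sum>k\<in>d. norm (g (Sup k) - g (Inf k))) < \<epsilon>" by simp
  qed
qed

section \<open>Slopes and growth\<close>

definition slope :: "(real \<Rightarrow> real) \<Rightarrow> real \<Rightarrow> real \<Rightarrow> real" where
  "slope f t s = (f s - f t) / (s - t)"

lemma slope_minus [simp]: "slope (\<lambda>t. - f t) t s = - slope f t s"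
  by (simp add: slope_def diff_divide_distrib minus_divide_left[symmetric])

lemma frequently_slope_imp_interval:
  assumes "\<exists>\<^sub>F s in at t. q < slope f t s" "0 < d"
  obtains u v where "u < v" "t \<in> {u..v}" "v - u < d"
    "q * increment (\<lambda>t. t) {u..v} < increment f {u..v}"
proof -
  obtain s where s: "s \<noteq> t" "dist s t < d" "q < slope f t s"
    using assms unfolding frequently_at by blast
  show ?thesis
  proof (cases "s < t")
    case True
    then have "q * (t - s) < f t - f s"
      using s(3) by (simp add: slope_def field_simps)
    then show ?thesis using True s by (intro that[of s t]) (auto simp: dist_real_def)
  next
    case False
    then have "q * (s - t) < f s - f t"
      using s(1,3) by (simp add: slope_def field_simps)
    then show ?thesis using False s by (intro that[of t s]) (auto simp: dist_real_def)
  qed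
qed

text \<open>
  For a fixed \<open>s\<close>, the slope towards \<open>s\<close> depends continuously on the base point \<open>t\<close>, so having a
  partner \<open>s\<close> within \<open>1/(n+1)\<close> and slope above \<open>q\<close> is an open condition on \<open>t\<close>. The set in question
  is the countable intersection of these open sets.
\<close>

lemma frequently_slope_lmeasurable:
  assumes f: "continuous_on {a..b} f"
  shows "{t \<in> {a<..<b}. \<exists>\<^sub>F s in at t. q < slope f t s} \<in> lmeasurable"
proof -
  define U where "U n s = {t \<in> {a<..<b} - {s}. dist s t < inverse (real (Suc n)) \<and> q < slope f t s}" for n s
  have "open (U n s)" for n s
  proof -
    have c: "continuous_on ({a<..<b} - {s}) (\<lambda>t. slope f t s)"
      unfolding slope_def
      by (intro continuous_intros continuous_on_subset[OF f]) auto
    have "open (({a<..<b} - {s}) \<inter> (\<lambda>t. slope f t s) -` {q<..})"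
      by (rule continuous_open_preimage[OF c]) auto
    then have "open ((({a<..<b} - {s}) \<inter> (\<lambda>t. slope f t s) -` {q<..}) \<inter> ball s (inverse (real (Suc n))))"
      by blast
    moreover have "\<dots> = U n s"
      by (auto simp: U_def)
    ultimately show ?thesis by simp
  qed
  then have "open (\<Union>s. U n s)" for n by blast
  then have "(\<Inter>n. \<Union>s. U n s) \<in> sets lebesgue"
    by (intro sets.countable_INT') auto
  moreover have "{t \<in> {a<..<b}. \<exists>\<^sub>F s in at t. q < slope f t s} = (\<Inter>n. \<Union>s. U n s)"
  proof (intro equalityI subsetI)
    fix t assume t: "t \<in> (\<Inter>n. \<Union>s. U n s)"
    have "\<exists>s. s \<noteq> t \<and> dist s t < d \<and> q < slope f t s" if "0 < d" for d
    proof -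
      obtain n where "inverse (real (Suc n)) < d" using reals_Archimedean[OF \<open>0 < d\<close>] by blast
      moreover obtain s where "t \<in> U n s" using t by blast
      ultimately show ?thesis by (intro exI[of _ s]) (auto simp: U_def)
    qed
    then show "t \<in> {t \<in> {a<..<b}. \<exists>\<^sub>F s in at t. q < slope f t s}"
      using t by (auto simp: frequently_at U_def)
  next
    fix t assume t: "t \<in> {t \<in> {a<..<b}. \<exists>\<^sub>F s in at t. q < slope f t s}"
    have "t \<in> (\<Union>s. U n s)" for n
    proof -
      have "0 < inverse (real (Suc n))" by simp
      then obtain s where "s \<noteq> t" "dist s t < inverse (real (Suc n))" "q < slope f t s"
        using t unfolding frequently_at by blast
      then show ?thesis using t by (auto simp: U_def)
    qed
    then show "t \<in> (\<Inter>n. \<Union>s. U n s)" by blast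
  qed
  ultimately have "{t \<in> {a<..<b}. \<exists>\<^sub>F s in at t. q < slope f t s} \<in> sets lebesgue"
    by (simp only:)
  then show ?thesis
    by (rule fmeasurableI2[OF lmeasurable_interval(1)[of a b], rotated]) auto
qed

lemma measure_le_diff_plus:
  assumes "E \<in> lmeasurable" "M \<in> lmeasurable"
  shows "measure lebesgue E \<le> measure lebesgue (E - M) + measure lebesgue M"
proof -
  have "measure lebesgue E \<le> measure lebesgue ((E - M) \<union> M)"
    using assms by (intro measure_mono_fmeasurable fmeasurable.Un fmeasurable_Diff fmeasurableD) auto
  also have "\<dots> \<le> measure lebesgue (E - M) + measure lebesgue M"
    using assms by (intro measure_Un_le fmeasurableD fmeasurable_Diff)
  finally show ?thesis .
qed

text \<open>
  Intervals of slope above \<open>q\<close> can be packed so densely into \<open>{a..b}\<close> that, by absolute continuity,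
  the gaps contribute almost nothing to \<open>f b - f a\<close>.
\<close>

lemma absolutely_continuous_growth_bound:
  fixes f :: "real \<Rightarrow> real"
  assumes f: "absolutely_continuous_fun_on {a..b} f" and "a \<le> b" and N: "negligible N"
    and steep: "\<And>t. t \<in> {a<..<b} - N \<Longrightarrow> \<exists>\<^sub>F s in at t. q < slope f t s"
  shows "q * (b - a) \<le> f b - f a"
proof (cases "a = b")
  case False
  with \<open>a \<le> b\<close> have "a < b" by simp
  show ?thesis
  proof (rule field_le_epsilon)
    fix e :: real assume "0 < e"
    then obtain \<delta> where \<delta>: "0 < \<delta>"
      "\<forall>r. r division_of \<Union>r \<and> \<Union>r \<subseteq> {a..b} \<and> (\<Sum>K\<in>r. increment (\<lambda>t. t) K) < \<delta>
        \<longrightarrow> \<bar>\<Sum>K\<in>r. increment f K\<bar> < e / 2"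
      using absolutely_continuous_fun_on_real[OF f half_gt_zero] by blast
    define \<eta> where "\<eta> = min \<delta> (e / (2 * (\<bar>q\<bar> + 1)))"
    have \<eta>: "0 < \<eta>" "\<eta> \<le> \<delta>" "\<bar>q\<bar> * \<eta> \<le> e / 2"
    proof -
      show "0 < \<eta>" "\<eta> \<le> \<delta>" using \<open>0 < e\<close> \<delta>(1) by (auto simp: \<eta>_def)
      have "\<bar>q\<bar> * \<eta> \<le> (\<bar>q\<bar> + 1) * (e / (2 * (\<bar>q\<bar> + 1)))"
        using \<open>0 < \<eta>\<close> by (intro mult_mono) (auto simp: \<eta>_def)
      also have "\<dots> = e / 2" by (simp add: divide_simps)
      finally show "\<bar>q\<bar> * \<eta> \<le> e / 2" .
    qed
    define E where "E = {a<..<b} - N"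
    have E: "E \<in> lmeasurable"
      unfolding E_def using N by (intro fmeasurable_Diff negligible_imp_sets) auto
    have mE: "measure lebesgue E = b - a"
    proof -
      have "measure lebesgue E = measure lebesgue {a<..<b}"
        unfolding E_def using N by (intro measure_negligible_symdiff) (auto intro: negligible_subset)
      then show ?thesis using \<open>a < b\<close> by simp
    qed
    obtain D where D: "interval_packing D"
      "\<And>K. K \<in> D \<Longrightarrow> K \<subseteq> {a..b} \<and> q * increment (\<lambda>t. t) K < increment f K"
      "measure lebesgue (E - \<Union>D) < \<eta>"
    proof (rule vitali_interval_packing[OF E \<eta>(1),
          where P = "\<lambda>K. K \<subseteq> {a..b} \<and> q * increment (\<lambda>t. t) K < increment f K"])
      fix t d :: real assume t: "t \<in> E" and "0 < d"
      then have "0 < min d (min (t - a) (b - t))" by (auto simp: E_def)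
      with steep t obtain u v where "u < v" "t \<in> {u..v}" "v - u < min d (min (t - a) (b - t))"
        "q * increment (\<lambda>t. t) {u..v} < increment f {u..v}"
        by (metis frequently_slope_imp_interval E_def)
      then show "\<exists>u v. u < v \<and> t \<in> {u..v} \<and> v - u < d
          \<and> {u..v} \<subseteq> {a..b} \<and> q * increment (\<lambda>t. t) {u..v} < increment f {u..v}"
        by (intro exI[of _ u] exI[of _ v]) auto
    qed blast
    have I: "interval_packing {{a..b}}"
      using \<open>a < b\<close> by (auto simp: interval_packing_def)
    obtain r where r: "r division_of \<Union>r" "\<Union>r \<subseteq> {a..b}"
      "\<And>g. (\<Sum>K\<in>r. increment g K) = (g b - g a) - (\<Sum>J\<in>D. increment g J)"
      using packing_remainder[OF I D(1)] D(2) \<open>a < b\<close> by auto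
    have "b - a \<le> measure lebesgue (E - \<Union>D) + (\<Sum>J\<in>D. increment (\<lambda>t. t) J)"
      using measure_le_diff_plus[OF E interval_packing_Union_lmeasurable[OF D(1)]]
      by (simp add: mE measure_interval_packing[OF D(1)])
    then have R: "(\<Sum>K\<in>r. increment (\<lambda>t. t) K) < \<eta>" using r(3) D(3) by simp
    have R0: "0 \<le> (\<Sum>K\<in>r. increment (\<lambda>t. t) K)"
      using division_ofD(4)[OF r(1)] division_ofD(3)[OF r(1)]
      by (intro sum_nonneg) (fastforce simp: increment_def)
    have "\<bar>\<Sum>K\<in>r. increment f K\<bar> < e / 2"
      using \<delta>(2) r(1,2) R \<eta>(2) by simp
    moreover have "q * (\<Sum>J\<in>D. increment (\<lambda>t. t) J) \<le> (\<Sum>J\<in>D. increment f J)"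
      unfolding sum_distrib_left using D(2) by (intro sum_mono) (simp add: less_imp_le)
    moreover have "q * (\<Sum>K\<in>r. increment (\<lambda>t. t) K) \<le> e / 2"
    proof -
      have "q * (\<Sum>K\<in>r. increment (\<lambda>t. t) K) \<le> \<bar>q\<bar> * \<eta>"
        using R R0 by (intro mult_mono) auto
      then show ?thesis using \<eta>(3) by simp
    qed
    moreover have "q * (b - a) = q * (\<Sum>J\<in>D. increment (\<lambda>t. t) J) + q * (\<Sum>K\<in>r. increment (\<lambda>t. t) K)"
      unfolding r(3) by (simp add: algebra_simps)
    ultimately show "q * (b - a) \<le> f b - f a + e"
      using r(3)[of f] by linarith
  qed
qed simp

section \<open>Differentiability almost everywhere\<close>

text \<open>
  Pack intervals of slope above \<open>q\<close> into an open set barely larger than \<open>E\<close>, and then intervals of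
  slope below \<open>p\<close> into the first packing. Both packings fill \<open>E\<close> up to a small error, so their
  lengths almost agree, and by absolute continuity so do their sums of increments. The common length
  \<open>L\<close> thus satisfies \<open>q L \<le> p L\<close> up to a small error, which forces \<open>E\<close> to have measure zero.
\<close>

lemma negligible_slopes_cross:
  fixes f :: "real \<Rightarrow> real"
  assumes f: "absolutely_continuous_fun_on {a..b} f" and "p < q"
    and E: "E \<in> lmeasurable" "E \<subseteq> {a<..<b}"
    and above: "\<And>t. t \<in> E \<Longrightarrow> \<exists>\<^sub>F s in at t. q < slope f t s"
    and below: "\<And>t. t \<in> E \<Longrightarrow> \<exists>\<^sub>F s in at t. slope f t s < p"
  shows "negligible E"
proof -
  have "measure lebesgue E \<le> e" if "0 < e" for e
  proof -
    \<comment> \<open>The final estimate is \<open>measure E \<le> \<kappa> * \<epsilon>\<close>.\<close>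
    define \<kappa> where "\<kappa> = (1 + \<bar>p\<bar>) / (q - p) + 1"
    define \<epsilon> where "\<epsilon> = e / \<kappa>"
    have "0 < \<kappa>" using \<open>p < q\<close> by (simp add: \<kappa>_def add_nonneg_pos)
    with \<open>0 < e\<close> have "0 < \<epsilon>" by (simp add: \<epsilon>_def)
    then obtain \<delta>\<^sub>0 where \<delta>\<^sub>0: "0 < \<delta>\<^sub>0"
      "\<forall>r. r division_of \<Union>r \<and> \<Union>r \<subseteq> {a..b} \<and> (\<Sum>K\<in>r. increment (\<lambda>t. t) K) < \<delta>\<^sub>0
        \<longrightarrow> \<bar>\<Sum>K\<in>r. increment f K\<bar> < \<epsilon>"
      using absolutely_continuous_fun_on_real[OF f] by blast
    define \<eta> where "\<eta> = min \<delta>\<^sub>0 \<epsilon> / 2"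
    have \<eta>: "0 < \<eta>" "2 * \<eta> \<le> \<delta>\<^sub>0" "2 * \<eta> \<le> \<epsilon>"
      using \<delta>\<^sub>0(1) \<open>0 < \<epsilon>\<close> by (auto simp: \<eta>_def)
    obtain W where W: "open W" "E \<subseteq> W" "W - E \<in> lmeasurable" "emeasure lebesgue (W - E) < ennreal \<eta>"
      using sets_lebesgue_outer_open[of E \<eta>] E(1) \<eta>(1) by (auto dest: fmeasurableD)
    have mW: "measure lebesgue (W - E) < \<eta>"
      using W(3,4) \<eta>(1) by (simp add: emeasure_eq_measure2 ennreal_less_iff)
    obtain D where D: "interval_packing D"
      "\<And>K. K \<in> D \<Longrightarrow> K \<subseteq> W \<inter> {a<..<b} \<and> q * increment (\<lambda>t. t) K < increment f K"
      "measure lebesgue (E - \<Union>D) < \<eta>"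
    proof (rule vitali_interval_packing[OF E(1) \<eta>(1),
          where P = "\<lambda>K. K \<subseteq> W \<inter> {a<..<b} \<and> q * increment (\<lambda>t. t) K < increment f K"])
      fix t d :: real assume t: "t \<in> E" and "0 < d"
      have "open (W \<inter> {a<..<b})" "t \<in> W \<inter> {a<..<b}" using W t E by auto
      then obtain d' where d': "0 < d'" "ball t d' \<subseteq> W \<inter> {a<..<b}" by (meson openE)
      obtain u v where uv: "u < v" "t \<in> {u..v}" "v - u < min d d'"
        "q * increment (\<lambda>t. t) {u..v} < increment f {u..v}"
        using frequently_slope_imp_interval[OF above[OF t], of "min d d'"] \<open>0 < d\<close> d'(1) by auto
      then have "{u..v} \<subseteq> ball t d'" by (auto simp: dist_real_def)
      then show "\<exists>u v. u < v \<and> t \<in> {u..v} \<and> v - u < d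
          \<and> {u..v} \<subseteq> W \<inter> {a<..<b} \<and> q * increment (\<lambda>t. t) {u..v} < increment f {u..v}"
        using uv d'(2) by (intro exI[of _ u] exI[of _ v]) auto
    qed blast
    \<comment> \<open>At an end point of some \<open>K\<close>, short intervals need not stay inside \<open>K\<close>; these points form a null set.\<close>
    define Z where "Z = (\<Union>K\<in>D. frontier K)"
    have "negligible (frontier K)" if "K \<in> D" for K
    proof -
      obtain u v where "K = {u..v}" using interval_packingD(3)[OF D(1) \<open>K \<in> D\<close>] by blast
      then show ?thesis by (simp add: negligible_convex_frontier)
    qed
    then have Z: "negligible Z"
      unfolding Z_def using interval_packingD(1)[OF D(1)] by (intro negligible_Union) auto
    define E' where "E' = E \<inter> \<Union>D - Z"
    have E': "E' \<in> lmeasurable"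
      unfolding E'_def using E(1) interval_packing_Union_lmeasurable[OF D(1)] negligible_imp_sets[OF Z]
      by (intro fmeasurable_Diff fmeasurable_Int_fmeasurable) (auto dest: fmeasurableD)
    obtain C where C: "interval_packing C"
      "\<And>J. J \<in> C \<Longrightarrow> (\<exists>K\<in>D. J \<subseteq> K) \<and> increment f J < p * increment (\<lambda>t. t) J"
      "measure lebesgue (E' - \<Union>C) < \<eta>"
    proof (rule vitali_interval_packing[OF E' \<eta>(1),
          where P = "\<lambda>J. (\<exists>K\<in>D. J \<subseteq> K) \<and> increment f J < p * increment (\<lambda>t. t) J"])
      fix t d :: real assume t: "t \<in> E'" and "0 < d"
      then obtain K where K: "K \<in> D" "t \<in> K" "t \<notin> frontier K"
        by (auto simp: E'_def Z_def)
      then have "t \<in> interior K"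
        using closure_subset by (auto simp: frontier_def)
      then obtain d' where d': "0 < d'" "ball t d' \<subseteq> K"
        by (meson mem_interior)
      have "\<exists>\<^sub>F s in at t. - p < slope (\<lambda>t. - f t) t s"
        using below t by (simp add: E'_def)
      then obtain u v where uv: "u < v" "t \<in> {u..v}" "v - u < min d d'"
        "- p * increment (\<lambda>t. t) {u..v} < increment (\<lambda>t. - f t) {u..v}"
        using frequently_slope_imp_interval[of "-p" "\<lambda>t. - f t" t "min d d'"] \<open>0 < d\<close> d'(1) by auto
      then have "{u..v} \<subseteq> ball t d'" by (auto simp: dist_real_def)
      then have "\<exists>K\<in>D. {u..v} \<subseteq> K" using d'(2) K(1) by blast
      then show "\<exists>u v. u < v \<and> t \<in> {u..v} \<and> v - u < d
          \<and> (\<exists>K\<in>D. {u..v} \<subseteq> K) \<and> increment f {u..v} < p * increment (\<lambda>t. t) {u..v}"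
        using uv by (intro exI[of _ u] exI[of _ v]) auto
    qed blast
    obtain r where r: "r division_of \<Union>r" "\<Union>r \<subseteq> \<Union>D"
      "\<And>g. (\<Sum>K\<in>r. increment g K) = (\<Sum>K\<in>D. increment g K) - (\<Sum>J\<in>C. increment g J)"
      using packing_remainder[OF D(1) C(1)] C(2) by blast
    let ?len = "increment (\<lambda>t. t)"
    have m1: "E' - \<Union>C \<in> lmeasurable"
      using E' interval_packing_Union_lmeasurable[OF C(1)] by (intro fmeasurable_Diff fmeasurableD)
    have m2: "Z \<in> lmeasurable" using Z by (rule negligible_imp_measurable)
    have "\<Union>C \<subseteq> \<Union>D" using C(2) by blast
    then have R: "(\<Sum>K\<in>r. ?len K) = measure lebesgue (\<Union>D - \<Union>C)"
      using measurable_measure_Diff[of "\<Union>D" lebesgue "\<Union>C"] interval_packing_Union_lmeasurable D(1) C(1)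
      by (simp add: r(3) measure_interval_packing fmeasurableD)
    also have "\<dots> \<le> measure lebesgue ((W - E) \<union> ((E' - \<Union>C) \<union> Z))"
    proof (rule measure_mono_fmeasurable)
      show "\<Union>D - \<Union>C \<subseteq> (W - E) \<union> ((E' - \<Union>C) \<union> Z)"
        using D(2) by (auto simp: E'_def)
      show "\<Union>D - \<Union>C \<in> sets lebesgue"
        using interval_packing_Union_lmeasurable D(1) C(1) by (auto dest: fmeasurableD)
    qed (intro fmeasurable.Un W(3) m1 m2)
    also have "\<dots> \<le> measure lebesgue (W - E) + (measure lebesgue (E' - \<Union>C) + measure lebesgue Z)"
      using measure_Un_le[OF fmeasurableD[OF W(3)] fmeasurableD[OF fmeasurable.Un[OF m1 m2]]]
        measure_Un_le[OF fmeasurableD[OF m1] fmeasurableD[OF m2]] by linarith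
    also have "\<dots> < 2 * \<eta>"
      using mW C(3) negligible_imp_measure0[OF Z] by simp
    finally have R_less: "(\<Sum>K\<in>r. ?len K) < 2 * \<eta>" .
    have R0: "0 \<le> (\<Sum>K\<in>r. ?len K)" by (simp add: R)
    have "\<Union>D \<subseteq> {a<..<b}" using D(2) by blast
    with r(2) have "\<Union>r \<subseteq> {a..b}" using greaterThanLessThan_subseteq_atLeastAtMost_iff[of a b a b] by blast
    then have rf: "\<bar>\<Sum>K\<in>r. increment f K\<bar> < \<epsilon>"
      using \<delta>\<^sub>0(2) r(1) R_less \<eta>(2) by simp
    have qD: "q * (\<Sum>K\<in>D. ?len K) \<le> (\<Sum>K\<in>D. increment f K)"
      unfolding sum_distrib_left using D(2) by (intro sum_mono) (simp add: less_imp_le)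
    have pC: "(\<Sum>J\<in>C. increment f J) \<le> p * (\<Sum>J\<in>C. ?len J)"
      unfolding sum_distrib_left using C(2) by (intro sum_mono) (simp add: less_imp_le)
    have "- p * (\<Sum>K\<in>r. ?len K) \<le> \<bar>p\<bar> * \<epsilon>"
      using R0 R_less \<eta>(3) by (intro mult_mono) auto
    moreover have "p * (\<Sum>J\<in>C. ?len J) = p * (\<Sum>K\<in>D. ?len K) - p * (\<Sum>K\<in>r. ?len K)"
      unfolding r(3) by (simp add: algebra_simps)
    ultimately have "q * (\<Sum>K\<in>D. ?len K) - p * (\<Sum>K\<in>D. ?len K) \<le> \<epsilon> + \<bar>p\<bar> * \<epsilon>"
      using rf qD pC r(3)[of f] by linarith
    then have "(q - p) * (\<Sum>K\<in>D. ?len K) \<le> (1 + \<bar>p\<bar>) * \<epsilon>"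
      by (simp only: left_diff_distrib distrib_right mult_1_left)
    then have "(\<Sum>K\<in>D. ?len K) \<le> (1 + \<bar>p\<bar>) / (q - p) * \<epsilon>"
      using \<open>p < q\<close> by (simp add: field_simps)
    moreover have "measure lebesgue E \<le> measure lebesgue (E - \<Union>D) + (\<Sum>K\<in>D. ?len K)"
      using measure_le_diff_plus[OF E(1) interval_packing_Union_lmeasurable[OF D(1)]]
      by (simp add: measure_interval_packing[OF D(1)])
    ultimately have "measure lebesgue E \<le> \<kappa> * \<epsilon>"
      using D(3) \<eta>(1,3) by (simp add: \<kappa>_def algebra_simps)
    then show ?thesis using \<open>0 < \<kappa>\<close> by (simp add: \<epsilon>_def)
  qed
  then have "measure lebesgue E \<le> 0"
    by (rule field_le_epsilon) simp
  then show ?thesis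
    using E(1) by (simp add: negligible_iff_measure order.antisym)
qed

text \<open>
  The claim is local. In a ball that is shorter than the \<open>\<delta>\<close> belonging to \<open>\<epsilon> = 1\<close>, the increments over
  a packing sum to less than \<open>1\<close>, so a packing with slopes above \<open>n\<close> has total length below \<open>1/n\<close>.
\<close>

lemma negligible_slopes_unbounded:
  fixes f :: "real \<Rightarrow> real"
  assumes f: "absolutely_continuous_fun_on {a..b} f"
    and E: "E \<in> lmeasurable" "E \<subseteq> {a<..<b}"
    and steep: "\<And>t n. t \<in> E \<Longrightarrow> \<exists>\<^sub>F s in at t. real n < slope f t s"
  shows "negligible E"
proof (rule iffD2[OF locally_negligible_alt], intro ballI)
  fix c assume c: "c \<in> E"
  obtain \<delta> where \<delta>: "0 < \<delta>"
    "\<forall>r. r division_of \<Union>r \<and> \<Union>r \<subseteq> {a..b} \<and> (\<Sum>K\<in>r. increment (\<lambda>t. t) K) < \<delta>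
        \<longrightarrow> \<bar>\<Sum>K\<in>r. increment f K\<bar> < 1"
    using absolutely_continuous_fun_on_real[OF f zero_less_one] by blast
  let ?len = "increment (\<lambda>t. t)"
  define B where "B = ball c (\<delta> / 3)"
  have EB: "E \<inter> B \<in> lmeasurable"
    by (rule fmeasurable_Int_fmeasurable[OF E(1)]) (simp add: B_def)
  have "measure lebesgue (E \<inter> B) \<le> 0 + e" if "0 < e" for e
  proof -
    \<comment> \<open>A slope above \<open>2 / e\<close> keeps the total length of the packing below \<open>e / 2\<close>.\<close>
    obtain n where n: "2 / e < real n" using reals_Archimedean2 by blast
    obtain D where D: "interval_packing D"
      "\<And>K. K \<in> D \<Longrightarrow> K \<subseteq> B \<inter> {a<..<b} \<and> real n * ?len K < increment f K"
      "measure lebesgue (E \<inter> B - \<Union>D) < e / 2"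
    proof (rule vitali_interval_packing[OF EB, of "e / 2"
          "\<lambda>K. K \<subseteq> B \<inter> {a<..<b} \<and> real n * ?len K < increment f K"])
      show "0 < e / 2" using \<open>0 < e\<close> by simp
      fix t d :: real assume t: "t \<in> E \<inter> B" and "0 < d"
      have "open (B \<inter> {a<..<b})" "t \<in> B \<inter> {a<..<b}" using t E by (auto simp: B_def)
      then obtain d' where d': "0 < d'" "ball t d' \<subseteq> B \<inter> {a<..<b}" by (meson openE)
      have "\<exists>\<^sub>F s in at t. real n < slope f t s" using steep t by blast
      then obtain u v where uv: "u < v" "t \<in> {u..v}" "v - u < min d d'"
        "real n * ?len {u..v} < increment f {u..v}"
        using frequently_slope_imp_interval[of "real n" f t "min d d'"] \<open>0 < d\<close> d'(1) by auto
      then have "{u..v} \<subseteq> ball t d'" by (auto simp: dist_real_def)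
      then show "\<exists>u v. u < v \<and> t \<in> {u..v} \<and> v - u < d
          \<and> {u..v} \<subseteq> B \<inter> {a<..<b} \<and> real n * ?len {u..v} < increment f {u..v}"
        using uv d'(2) by (intro exI[of _ u] exI[of _ v]) auto
    qed blast
    have "measure lebesgue (\<Union>D) \<le> measure lebesgue B"
    proof (rule measure_mono_fmeasurable)
      show "\<Union>D \<subseteq> B" using D(2) by blast
      show "\<Union>D \<in> sets lebesgue"
        by (rule fmeasurableD[OF interval_packing_Union_lmeasurable[OF D(1)]])
    qed (simp add: B_def)
    also have "measure lebesgue B = 2 * \<delta> / 3"
      using \<delta>(1) by (simp add: B_def ball_eq_greaterThanLessThan)
    finally have "(\<Sum>K\<in>D. ?len K) < \<delta>"
      using \<delta>(1) by (simp add: measure_interval_packing[OF D(1)])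
    moreover have "\<Union>D \<subseteq> {a<..<b}" using D(2) by blast
    then have "\<Union>D \<subseteq> {a..b}" using greaterThanLessThan_subseteq_atLeastAtMost_iff[of a b a b] by blast
    ultimately have "\<bar>\<Sum>K\<in>D. increment f K\<bar> < 1"
      using \<delta>(2) interval_packing_division[OF D(1)] by blast
    then have "(\<Sum>K\<in>D. increment f K) < 1" by simp
    moreover have "real n * (\<Sum>K\<in>D. ?len K) \<le> (\<Sum>K\<in>D. increment f K)"
      unfolding sum_distrib_left using D(2) by (intro sum_mono) (simp add: less_imp_le)
    moreover have "2 / e * (\<Sum>K\<in>D. ?len K) \<le> real n * (\<Sum>K\<in>D. ?len K)"
    proof (rule mult_right_mono)
      show "0 \<le> (\<Sum>K\<in>D. ?len K)"
        unfolding measure_interval_packing[OF D(1), symmetric] by simp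
    qed (use n in simp)
    ultimately have "2 / e * (\<Sum>K\<in>D. ?len K) < 1" by simp
    then have "(\<Sum>K\<in>D. ?len K) < e / 2" using that by (simp add: field_simps)
    then show ?thesis
      using D(3) measure_le_diff_plus[OF EB interval_packing_Union_lmeasurable[OF D(1)]]
      by (simp add: measure_interval_packing[OF D(1)])
  qed
  then have "measure lebesgue (E \<inter> B) \<le> 0"
    by (rule field_le_epsilon)
  then have "negligible (E \<inter> B)"
    using EB by (simp add: negligible_iff_measure order.antisym)
  then show "\<exists>U. openin (top_of_set E) U \<and> c \<in> U \<and> negligible U"
  proof (intro exI conjI)
    show "openin (top_of_set E) (E \<inter> B)" by (simp add: B_def openin_open_Int)
    show "c \<in> E \<inter> B" using c \<delta>(1) by (simp add: B_def)
  qed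
qed

text \<open>
  If no pair \<open>p < q\<close> of rationals is crossed frequently from both sides, then the upper and lower limits agree;
  rational levels suffice, which keeps the union of exceptional null sets countable.
\<close>

lemma tendsto_if_no_rational_crossing:
  fixes g :: "'a \<Rightarrow> real"
  assumes "F \<noteq> bot"
    and upper: "\<forall>\<^sub>F s in F. g s \<le> M" and lower: "\<forall>\<^sub>F s in F. m \<le> g s"
    and cross: "\<And>p q. p \<in> \<rat> \<Longrightarrow> q \<in> \<rat> \<Longrightarrow> p < q \<Longrightarrow> (\<exists>\<^sub>F s in F. q < g s) \<Longrightarrow> \<not> (\<exists>\<^sub>F s in F. g s < p)"
  shows "\<exists>L. (g \<longlongrightarrow> L) F"
proof -
  define S where "S = {q. \<forall>\<^sub>F s in F. g s \<le> q}"
  have "S \<noteq> {}" using upper by (auto simp: S_def)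
  have mS: "m \<le> q" if "q \<in> S" for q
  proof -
    have "\<forall>\<^sub>F s in F. g s \<le> q" using that by (simp add: S_def)
    then have "\<forall>\<^sub>F s in F. m \<le> q"
      using lower by eventually_elim simp
    then show ?thesis using \<open>F \<noteq> bot\<close> by simp
  qed
  have bdd: "bdd_below S" using mS by (rule bdd_belowI)
  have "(g \<longlongrightarrow> Inf S) F"
  proof (rule order_tendstoI)
    fix a assume "a < Inf S"
    then obtain p where p: "p \<in> \<rat>" "a < p" "p < Inf S" using Rats_dense_in_real by blast
    then obtain q where q: "q \<in> \<rat>" "p < q" "q < Inf S" using Rats_dense_in_real by blast
    have "q \<notin> S" using q(3) cInf_lower[OF _ bdd] by force
    then have "\<exists>\<^sub>F s in F. q < g s" by (simp add: S_def frequently_def not_less)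
    then have "\<forall>\<^sub>F s in F. p \<le> g s"
      using cross[OF p(1) q(1,2)] by (simp add: frequently_def not_less)
    then show "\<forall>\<^sub>F s in F. a < g s"
      by eventually_elim (use p in simp)
  next
    fix a assume "Inf S < a"
    then obtain q where "q \<in> S" "q < a" using cInf_lessD[OF \<open>S \<noteq> {}\<close>] by blast
    then have "\<forall>\<^sub>F s in F. g s \<le> q" by (simp add: S_def)
    then show "\<forall>\<^sub>F s in F. g s < a"
      by eventually_elim (use \<open>q < a\<close> in simp)
  qed
  then show ?thesis by blast
qed

lemma absolutely_continuous_real_ae_differentiable:
  fixes f :: "real \<Rightarrow> real"
  assumes f: "absolutely_continuous_fun_on {a..b} f"
  obtains N where "negligible N" "\<And>t. t \<in> {a<..<b} - N \<Longrightarrow> f differentiable at t"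
proof -
  have f': "absolutely_continuous_fun_on {a..b} (\<lambda>t. - f t)"
    by (rule absolutely_continuous_fun_on_dominated[OF f, of _ 1]) simp
  note cont = f[THEN absolutely_continuous_fun_on_imp_continuous_on]
    f'[THEN absolutely_continuous_fun_on_imp_continuous_on]
  define Hi where "Hi q = {t \<in> {a<..<b}. \<exists>\<^sub>F s in at t. q < slope f t s}" for q
  define Lo where "Lo p = {t \<in> {a<..<b}. \<exists>\<^sub>F s in at t. slope f t s < p}" for p
  have Hi: "Hi q \<in> lmeasurable" for q
    unfolding Hi_def by (rule frequently_slope_lmeasurable[OF cont(1)])
  have Lo: "Lo p \<in> lmeasurable" for p
    using frequently_slope_lmeasurable[OF cont(2), of "-p"] by (simp add: Lo_def)
  have cross: "negligible (Hi q \<inter> Lo p)" if "p < q" for p q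
    using Hi Lo by (intro negligible_slopes_cross[OF f that]) (auto simp: Hi_def Lo_def fmeasurable_Int_fmeasurable fmeasurableD)
  have up: "negligible (\<Inter>n. Hi (real n))"
  proof (rule negligible_slopes_unbounded[OF f])
    show "(\<Inter>n. Hi (real n)) \<in> lmeasurable"
    proof (rule fmeasurableI2)
      show "Hi (real 0) \<in> lmeasurable" by (rule Hi)
      show "(\<Inter>n. Hi (real n)) \<in> sets lebesgue"
        using Hi[THEN fmeasurableD] by (intro sets.countable_INT') auto
    qed (rule INT_lower, rule UNIV_I)
  qed (auto simp: Hi_def)
  have down: "negligible (\<Inter>n. Lo (- real n))"
  proof (rule negligible_slopes_unbounded[OF f'])
    show "(\<Inter>n. Lo (- real n)) \<in> lmeasurable"
    proof (rule fmeasurableI2)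
      show "Lo (- real 0) \<in> lmeasurable" by (rule Lo)
      show "(\<Inter>n. Lo (- real n)) \<in> sets lebesgue"
        using Lo[THEN fmeasurableD] by (intro sets.countable_INT') auto
    qed (rule INT_lower, rule UNIV_I)
  qed (auto simp: Lo_def less_minus_iff)
  \<comment> \<open>The points at which some pair of rational levels is crossed.\<close>
  define X where "X = (\<Union>(p, q)\<in>{(p, q). p \<in> \<rat> \<and> q \<in> \<rat> \<and> p < q}. Hi q \<inter> Lo p)"
  have "negligible X"
    unfolding X_def
  proof (rule negligible_countable_Union)
    have "countable (\<rat> \<times> \<rat> :: (real \<times> real) set)"
      by (intro countable_SIGMA countable_rat)
    then have "countable {(p, q). p \<in> \<rat> \<and> q \<in> \<rat> \<and> p < (q :: real)}"
      by (rule countable_subset[rotated]) auto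
    then show "countable ((\<lambda>(p, q). Hi q \<inter> Lo p) ` {(p, q). p \<in> \<rat> \<and> q \<in> \<rat> \<and> p < q})"
      by blast
  qed (use cross in auto)
  with up down have N: "negligible (X \<union> (\<Inter>n. Hi (real n)) \<union> (\<Inter>n. Lo (- real n)))"
    by (intro negligible_Un)
  show ?thesis
  proof (rule that[OF N])
    fix t assume t: "t \<in> {a<..<b} - (X \<union> (\<Inter>n. Hi (real n)) \<union> (\<Inter>n. Lo (- real n)))"
    obtain n m where n: "t \<notin> Hi (real n)" and m: "t \<notin> Lo (- real m)" using t by blast
    have "\<exists>L. (slope f t \<longlongrightarrow> L) (at t)"
    proof (rule tendsto_if_no_rational_crossing)
      show "\<forall>\<^sub>F s in at t. slope f t s \<le> real n"
        using n t by (simp add: Hi_def frequently_def not_less)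
      show "\<forall>\<^sub>F s in at t. - real m \<le> slope f t s"
        using m t by (simp add: Lo_def frequently_def not_less)
      show "\<not> (\<exists>\<^sub>F s in at t. slope f t s < p)"
        if "p \<in> \<rat>" "q \<in> \<rat>" "p < q" "\<exists>\<^sub>F s in at t. q < slope f t s" for p q
        using that t by (auto simp: X_def Hi_def Lo_def)
    qed simp
    then obtain L where "(slope f t \<longlongrightarrow> L) (at t)" by blast
    then have "(f has_field_derivative L) (at t)"
      by (simp add: has_field_derivative_iff slope_def[abs_def])
    then show "f differentiable at t"
      by (auto simp: differentiable_def has_field_derivative_def)
  qed
qed

lemma absolutely_continuous_ae_differentiable:
  fixes f :: "real \<Rightarrow> 'a::euclidean_space"
  assumes f: "absolutely_continuous_fun_on {a..b} f"
  obtains N where "negligible N" "\<And>t. t \<in> {a<..<b} - N \<Longrightarrow> f differentiable at t"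
proof -
  have "\<exists>N. negligible N \<and> (\<forall>t\<in>{a<..<b} - N. (\<lambda>t. f t \<bullet> i) differentiable at t)"
    if i: "i \<in> Basis" for i
  proof -
    have "absolutely_continuous_fun_on {a..b} (\<lambda>t. f t \<bullet> i)"
    proof (rule absolutely_continuous_fun_on_dominated[OF f, of _ 1])
      show "norm (f s \<bullet> i - f t \<bullet> i) \<le> 1 * norm (f s - f t)" for s t
        using Basis_le_norm[OF i, of "f s - f t"] by (simp add: inner_diff_left)
    qed
    then show ?thesis
      by (metis absolutely_continuous_real_ae_differentiable)
  qed
  then obtain N where N: "\<And>i. i \<in> Basis \<Longrightarrow> negligible (N i)"
    "\<And>i t. i \<in> Basis \<Longrightarrow> t \<in> {a<..<b} - N i \<Longrightarrow> (\<lambda>t. f t \<bullet> i) differentiable at t"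
    by metis
  show ?thesis
  proof (rule that[of "\<Union>(N ` Basis)"])
    show "negligible (\<Union>(N ` Basis))"
      using N(1) by (intro negligible_Union) auto
    show "f differentiable at t" if "t \<in> {a<..<b} - \<Union>(N ` Basis)" for t
      using N(2) that by (subst differentiable_componentwise_within) auto
  qed
qed

section \<open>Monotonicity from the sign of the derivative\<close>

text \<open>
  Where the derivative is nonpositive, \<open>-f\<close> has slopes above \<open>-e\<close> for every \<open>e > 0\<close>, so the growth
  bound applies to \<open>-f\<close>.
\<close>

lemma absolutely_continuous_antimono:
  fixes f :: "real \<Rightarrow> real"
  assumes f: "absolutely_continuous_fun_on {a..b} f" and "a \<le> b" and N: "negligible N"
    and deriv: "\<And>t. t \<in> {a<..<b} - N \<Longrightarrow> \<exists>D\<le>0. (f has_real_derivative D) (at t)"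
  shows "f b \<le> f a"
proof -
  have f': "absolutely_continuous_fun_on {a..b} (\<lambda>t. - f t)"
    by (rule absolutely_continuous_fun_on_dominated[OF f, of _ 1]) simp
  have "f b - f a \<le> 0 + e * (b - a)" if "0 < e" for e
  proof -
    have "- e * (b - a) \<le> - f b - - f a"
    proof (rule absolutely_continuous_growth_bound[OF f' \<open>a \<le> b\<close> N])
      fix t assume t: "t \<in> {a<..<b} - N"
      then obtain D where "D \<le> 0" and D: "(slope f t \<longlongrightarrow> D) (at t)"
        using deriv by (force simp: has_field_derivative_iff slope_def[abs_def])
      then have "\<forall>\<^sub>F s in at t. slope f t s < e"
        using \<open>0 < e\<close> by (intro order_tendstoD(2)[OF D]) simp
      then show "\<exists>\<^sub>F s in at t. - e < slope (\<lambda>t. - f t) t s"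
        by (simp add: eventually_frequently)
    qed
    then show ?thesis by simp
  qed
  note bound = this
  have "f b - f a \<le> 0"
  proof (rule field_le_epsilon)
    fix e :: real assume "0 < e"
    then have "f b - f a \<le> 0 + e / (b - a + 1) * (b - a)"
      using \<open>a \<le> b\<close> by (intro bound) simp
    also have "\<dots> \<le> 0 + e"
      using \<open>a \<le> b\<close> \<open>0 < e\<close> by (simp add: field_simps)
    finally show "f b - f a \<le> 0 + e" .
  qed
  then show ?thesis by simp
qed

section \<open>Quadratic forms\<close>

lemma symmetric_matrix_inner_commute:
  fixes A :: "real^'n^'n"
  assumes "transpose A = A"
  shows "(A *v v) \<bullet> w = v \<bullet> (A *v w)"
  using dot_lmul_matrix[of v A w] assms by (metis transpose_matrix_vector)

text \<open>
  Otherwise, moving from \<open>d\<close> a short way in the direction \<open>- A d\<close> would make the quadratic form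
  negative: its first-order change is \<open>- 2 |A d|\<^sup>2\<close> per unit step.
\<close>

lemma pos_semidef_isotropic_in_kernel:
  fixes A :: "real^'n^'n"
  assumes A: "pos_semidef_matrix A" and "d \<bullet> (A *v d) = 0"
  shows "A *v d = 0"
proof (rule ccontr)
  assume nz: "A *v d \<noteq> 0"
  define e where "e = A *v d"
  define c where "c = e \<bullet> (A *v e)"
  have sym: "transpose A = A" and psd: "0 \<le> v \<bullet> (A *v v)" for v
    using A by (auto simp: pos_semidef_matrix_def)
  have "0 < e \<bullet> e" using nz by (simp add: e_def)
  have "0 \<le> c" using psd by (simp add: c_def)
  have de: "d \<bullet> (A *v e) = e \<bullet> e"
    using symmetric_matrix_inner_commute[OF sym, of d e] by (simp add: e_def)
  have q: "0 \<le> 2 * s * (e \<bullet> e) + s\<^sup>2 * c" for s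
  proof -
    have "(d + s *\<^sub>R e) \<bullet> (A *v (d + s *\<^sub>R e)) = 2 * s * (e \<bullet> e) + s\<^sup>2 * c"
      using assms(2) de
      by (simp add: matrix_vector_right_distrib matrix_vector_mult_scaleR inner_add_left inner_add_right
          power2_eq_square c_def algebra_simps flip: e_def)
    then show ?thesis using psd[of "d + s *\<^sub>R e"] by simp
  qed
  \<comment> \<open>A step so short that the quadratic term is at most half of the linear one; \<open>c + 1\<close> avoids division by zero.\<close>
  define s where "s = - (e \<bullet> e) / (c + 1)"
  have "s < 0" using \<open>0 < e \<bullet> e\<close> \<open>0 \<le> c\<close> by (simp add: s_def)
  moreover have "0 \<le> s * (2 * (e \<bullet> e) + s * c)"
    using q[of s] by (simp add: power2_eq_square algebra_simps)
  ultimately have "2 * (e \<bullet> e) + s * c \<le> 0"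
    by (simp add: zero_le_mult_iff)
  moreover have "- s * c \<le> e \<bullet> e"
    using \<open>0 < e \<bullet> e\<close> \<open>0 \<le> c\<close> by (simp add: s_def field_simps)
  ultimately show False using \<open>0 < e \<bullet> e\<close> by simp
qed

section \<open>Decay of the energy along a trajectory\<close>

text \<open>
  The energy \<open>(x \<bullet> A x)/2\<close> has gradient \<open>A x\<close>, so the drift condition says that every single component
  of the motion, and not just the motion as a whole, goes against the gradient.
\<close>

locale opposing_drift =
  fixes A :: "real^'n^'n" and x :: "real \<Rightarrow> real^'n"
  assumes psd: "pos_semidef_matrix A"
    and ac: "locally_absolutely_continuous_fun_on {0..} x"
    and drift: "\<And>i. AE t in lebesgue_on {0..}.
           vector_derivative x (at t within {0..}) $ i * (row i A \<bullet> x t) \<le> 0"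
begin

lemma A_symmetric: "transpose A = A"
  using psd by (simp add: pos_semidef_matrix_def)

definition energy :: "real^'n \<Rightarrow> real" where
  "energy v = (v \<bullet> (A *v v)) / 2"

lemma continuous_energy: "continuous_on S energy"
  unfolding energy_def by (intro continuous_intros matrix_vector_mult_linear_continuous_on) simp

lemma energy_add: "energy (v + d) = energy v + d \<bullet> (A *v v) + (d \<bullet> (A *v d)) / 2"
  using symmetric_matrix_inner_commute[OF A_symmetric, of v d]
  by (simp add: energy_def matrix_vector_right_distrib inner_add_left inner_add_right inner_commute)

lemma ac_interval: "0 \<le> a \<Longrightarrow> absolutely_continuous_fun_on {a..b} x"
  using ac by (simp add: locally_absolutely_continuous_fun_on_def)

lemma continuous_x: "continuous_on {0..} x"
  unfolding continuous_on_eq_continuous_within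
proof
  fix t :: real assume t: "t \<in> {0..}"
  have "continuous_on {0..t + 1} x"
    using absolutely_continuous_fun_on_imp_continuous_on[OF ac_interval[of 0]] by simp
  then have "continuous (at t within {0..t + 1}) x"
    using t by (simp add: continuous_on_eq_continuous_within)
  moreover have "at t within {0..t + 1} = at t within {0..}"
    using t by (intro at_within_nhd[of t "{..<t + 1}"]) auto
  ultimately show "continuous (at t within {0..}) x" by (simp add: continuous_within)
qed

text \<open>
  The hypothesis speaks of \<open>vector_derivative\<close> even where the trajectory has no derivative. Differentiability
  almost everywhere turns it into a statement about genuine derivatives outside one null set that
  serves all components.
\<close>

lemma drift_ae:
  obtains N where "negligible N"
    "\<And>t. 0 < t \<Longrightarrow> t \<notin> N \<Longrightarrow>
      \<exists>x'. (x has_vector_derivative x') (at t) \<and> (\<forall>i. x' $ i * (A *v x t) $ i \<le> 0)"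
proof -
  have "\<exists>N. negligible N \<and> (\<forall>t\<in>{0<..<real n} - N. x differentiable at t)" for n
    using absolutely_continuous_ae_differentiable[OF ac_interval[of 0 "real n"]] by (metis order_refl)
  then obtain M where M: "\<And>n. negligible (M n)"
    "\<And>n t. t \<in> {0<..<real n} - M n \<Longrightarrow> x differentiable at t"
    by metis
  have "AE t in lebesgue_on {0..}.
      \<forall>i. vector_derivative x (at t within {0..}) $ i * (row i A \<bullet> x t) \<le> 0"
    by (rule eventually_all_finite) (rule drift)
  then have "AE t in lebesgue. t \<in> {0..} \<longrightarrow>
      (\<forall>i. vector_derivative x (at t within {0..}) $ i * (row i A \<bullet> x t) \<le> 0)"
    by (simp add: AE_restrict_space_iff)
  then obtain N where N: "negligible N"
    "\<And>t i. t \<notin> N \<Longrightarrow> 0 \<le> t \<Longrightarrow> vector_derivative x (at t within {0..}) $ i * (row i A \<bullet> x t) \<le> 0"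
    by (auto simp: eventually_ae_filter negligible_iff_null_sets)
  show ?thesis
  proof (rule that[of "N \<union> (\<Union>n. M n)"])
    show "negligible (N \<union> (\<Union>n. M n))"
      using N(1) M(1) by (intro negligible_Un negligible_Union_nat) auto
    fix t :: real assume t: "0 < t" "t \<notin> N \<union> (\<Union>n. M n)"
    obtain n where "t < real n" using reals_Archimedean2 by blast
    then have "x differentiable at t" using M(2)[of t n] t by auto
    then have "(x has_vector_derivative vector_derivative x (at t)) (at t)"
      by (simp add: vector_derivative_works)
    moreover have "at t within {0..} = at t"
      using t by (intro at_within_interior) (simp add: interior_real_atLeast)
    then have "\<forall>i. vector_derivative x (at t) $ i * (A *v x t) $ i \<le> 0"
      using N(2)[of t] t by (simp add: matrix_vector_mul_component row_def vec_lambda_eta)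
    ultimately show "\<exists>x'. (x has_vector_derivative x') (at t) \<and> (\<forall>i. x' $ i * (A *v x t) $ i \<le> 0)"
      by blast
  qed
qed

text \<open>
  The derivative of the tilted energy is \<open>\<Sum>\<^sub>j x'\<^sub>j (A x)\<^sub>j - c x'\<^sub>i\<close>. The terms with \<open>j \<noteq> i\<close> are nonpositive.
  The rest is \<open>x'\<^sub>i ((A x)\<^sub>i - c)\<close>, and since \<open>|c| \<le> |(A x)\<^sub>i|\<close>, subtracting \<open>c\<close> cannot reverse the sign of
  \<open>(A x)\<^sub>i\<close>; so this is nonpositive as well.
\<close>

lemma tilted_energy_decreasing:
  assumes "0 \<le> s" "s \<le> t"
    and c: "\<And>u. u \<in> {s..t} \<Longrightarrow> \<bar>c\<bar> \<le> \<bar>(A *v x u) $ i\<bar>"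
  shows "energy (x t) - c * x t $ i \<le> energy (x s) - c * x s $ i"
proof -
  define F where "F v = energy v - c * v $ i" for v
  obtain N where N: "negligible N"
    "\<And>u. 0 < u \<Longrightarrow> u \<notin> N \<Longrightarrow>
      \<exists>x'. (x has_vector_derivative x') (at u) \<and> (\<forall>i. x' $ i * (A *v x u) $ i \<le> 0)"
    using drift_ae by blast
  have "compact (x ` {s..t})"
    using assms(1) by (intro compact_continuous_image continuous_on_subset[OF continuous_x]) auto
  then obtain B where B: "\<And>u. u \<in> {s..t} \<Longrightarrow> norm (x u) \<le> B"
    by (meson bounded_iff compact_imp_bounded image_eqI)
  obtain K where K: "\<And>v. norm (A *v v) \<le> norm v * K"
    using bounded_linear.bounded[OF matrix_vector_mul_bounded_linear[of A]] by blast
  have "absolutely_continuous_fun_on {s..t} (\<lambda>u. F (x u))"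
  proof (rule absolutely_continuous_fun_on_dominated[OF ac_interval[OF assms(1)]])
    fix u w assume u: "u \<in> {s..t}" "w \<in> {s..t}"
    define d where "d = x u - x w"
    have "x u \<bullet> (A *v x w) = x w \<bullet> (A *v x u)"
      using symmetric_matrix_inner_commute[OF A_symmetric, of "x w" "x u"] by (simp add: inner_commute)
    then have "energy (x u) - energy (x w) = (d \<bullet> (A *v x u) + d \<bullet> (A *v x w)) / 2"
      unfolding energy_def d_def inner_diff_left by (simp add: diff_divide_distrib add_divide_distrib)
    moreover have "d $ i = x u $ i - x w $ i" by (simp add: d_def)
    ultimately have "F (x u) - F (x w) = (d \<bullet> (A *v x u) + d \<bullet> (A *v x w)) / 2 - c * d $ i"
      unfolding F_def by (simp only: right_diff_distrib)
    also have "\<bar>\<dots>\<bar> \<le> (\<bar>d \<bullet> (A *v x u)\<bar> + \<bar>d \<bullet> (A *v x w)\<bar>) / 2 + \<bar>c\<bar> * \<bar>d $ i\<bar>"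
    proof -
      have "\<bar>(p + q) / 2 - k\<bar> \<le> (\<bar>p\<bar> + \<bar>q\<bar>) / 2 + \<bar>k\<bar>" for p q k :: real
        unfolding add_divide_distrib by linarith
      then show ?thesis by (simp only: abs_mult[symmetric])
    qed
    also have "\<dots> \<le> (norm d * (B * \<bar>K\<bar>) + norm d * (B * \<bar>K\<bar>)) / 2 + \<bar>c\<bar> * norm d"
    proof -
      have "\<bar>d \<bullet> (A *v x y)\<bar> \<le> norm d * (B * \<bar>K\<bar>)" if "y \<in> {s..t}" for y
      proof -
        have "norm (A *v x y) \<le> norm (x y) * \<bar>K\<bar>"
          by (rule order_trans[OF K mult_left_mono]) auto
        also have "\<dots> \<le> B * \<bar>K\<bar>" using B[OF that] by (intro mult_right_mono) auto
        finally show ?thesis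
          using Cauchy_Schwarz_ineq2[of d "A *v x y"] mult_left_mono[of _ _ "norm d"]
          by (meson norm_ge_zero order_trans)
      qed
      then show ?thesis
        using u component_le_norm_cart[of d i]
        by (intro add_mono divide_right_mono mult_left_mono) auto
    qed
    also have "\<dots> = (B * \<bar>K\<bar> + \<bar>c\<bar>) * norm (x u - x w)"
      by (simp add: d_def algebra_simps)
    finally show "norm (F (x u) - F (x w)) \<le> (B * \<bar>K\<bar> + \<bar>c\<bar>) * norm (x u - x w)" by simp
  qed
  then have "F (x t) \<le> F (x s)"
  proof (rule absolutely_continuous_antimono[OF _ \<open>s \<le> t\<close> N(1)])
    fix u assume u: "u \<in> {s<..<t} - N"
    then obtain x' where x': "(x has_vector_derivative x') (at u)"
      and le: "\<And>j. x' $ j * (A *v x u) $ j \<le> 0"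
      using N(2)[of u] assms(1) by auto
    have Ax': "((\<lambda>u. A *v x u) has_vector_derivative A *v x') (at u)"
      by (rule bounded_linear.has_vector_derivative[OF matrix_vector_mul_bounded_linear x'])
    have xi': "((\<lambda>u. x u $ i) has_vector_derivative x' $ i) (at u)"
      by (rule bounded_linear.has_vector_derivative[OF bounded_linear_vec_nth x'])
    have "((\<lambda>u. x u \<bullet> (A *v x u)) has_vector_derivative x u \<bullet> (A *v x') + x' \<bullet> (A *v x u)) (at u)"
      using bounded_bilinear.has_vector_derivative[OF bounded_bilinear_inner x' Ax'] .
    then have E': "((\<lambda>u. x u \<bullet> (A *v x u)) has_real_derivative x u \<bullet> (A *v x') + x' \<bullet> (A *v x u)) (at u)"
      by (simp add: has_real_derivative_iff_has_vector_derivative)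
    have "((\<lambda>u. F (x u)) has_real_derivative
        (x u \<bullet> (A *v x') + x' \<bullet> (A *v x u)) / 2 - c * x' $ i) (at u)"
      unfolding F_def energy_def
      by (intro DERIV_diff DERIV_cdivide DERIV_cmult E'
          xi'[folded has_real_derivative_iff_has_vector_derivative])
    moreover have "(x u \<bullet> (A *v x') + x' \<bullet> (A *v x u)) / 2 = x' \<bullet> (A *v x u)"
      using symmetric_matrix_inner_commute[OF A_symmetric, of "x u" x'] by (simp add: inner_commute)
    moreover have "x' \<bullet> (A *v x u) - c * x' $ i \<le> 0"
    proof -
      have "x' \<bullet> (A *v x u) = x' $ i * (A *v x u) $ i + (\<Sum>j\<in>UNIV - {i}. x' $ j * (A *v x u) $ j)"
        by (simp add: inner_vec_def sum.remove[of UNIV i])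
      also have "\<dots> \<le> x' $ i * (A *v x u) $ i + 0"
        using le by (intro add_left_mono sum_nonpos) auto
      finally have "x' \<bullet> (A *v x u) \<le> x' $ i * (A *v x u) $ i" by simp
      moreover have "x' $ i * (A *v x u) $ i - c * x' $ i \<le> 0"
      proof -
        have "\<bar>c\<bar> \<le> \<bar>(A *v x u) $ i\<bar>" using c[of u] u by simp
        then have "\<bar>c * x' $ i\<bar> \<le> \<bar>x' $ i * (A *v x u) $ i\<bar>"
          using mult_right_mono[of _ _ "\<bar>x' $ i\<bar>"] by (simp add: abs_mult mult.commute[of "x' $ i"])
        then show ?thesis using le[of i] by linarith
      qed
      ultimately show ?thesis by simp
    qed
    ultimately show "\<exists>D\<le>0. ((\<lambda>u. F (x u)) has_real_derivative D) (at u)"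
      by (intro exI[of _ "x' \<bullet> (A *v x u) - c * x' $ i"]) simp
  qed
  then show ?thesis by (simp add: F_def)
qed

lemma energy_decreasing: "0 \<le> s \<Longrightarrow> s \<le> t \<Longrightarrow> energy (x t) \<le> energy (x s)"
  using tilted_energy_decreasing[of s t 0] by simp

text \<open>
  Both signs of the tilt together bound the displacement: while \<open>(A x)\<^sub>i\<close> stays away from zero, motion
  of \<open>x\<^sub>i\<close> has to be paid for by energy.
\<close>

lemma displacement_le_energy_loss:
  assumes "0 \<le> s" "s \<le> t" "0 \<le> c"
    and "\<And>u. u \<in> {s..t} \<Longrightarrow> c \<le> \<bar>(A *v x u) $ i\<bar>"
  shows "c * \<bar>x t $ i - x s $ i\<bar> \<le> energy (x s) - energy (x t)"
proof -
  have "\<bar>c\<bar> \<le> \<bar>(A *v x u) $ i\<bar>" "\<bar>- c\<bar> \<le> \<bar>(A *v x u) $ i\<bar>" if "u \<in> {s..t}" for u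
    using assms(3) assms(4)[OF that] by simp_all
  then have "energy (x t) - c * x t $ i \<le> energy (x s) - c * x s $ i"
    "energy (x t) - - c * x t $ i \<le> energy (x s) - - c * x s $ i"
    using assms(1,2) by (intro tilted_energy_decreasing; blast)+
  then have "\<bar>c * (x t $ i - x s $ i)\<bar> \<le> energy (x s) - energy (x t)"
    by (simp add: abs_le_iff algebra_simps)
  then show ?thesis using assms(3) by (simp add: abs_mult)
qed

text \<open>
  The energy is monotone, so its limit along one sequence of times is its limit.
\<close>

lemma energy_tendsto_accumulation:
  assumes "accumulation_point_at_top x p"
  shows "((\<lambda>t. energy (x t)) \<longlongrightarrow> energy p) at_top"
proof -
  obtain s :: "nat \<Rightarrow> real" where s: "\<And>m. 0 \<le> s m" "filterlim s at_top sequentially"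
    "(\<lambda>m. x (s m)) \<longlonglongrightarrow> p"
    using assms by (auto simp: accumulation_point_at_top_def)
  have Es: "(\<lambda>m. energy (x (s m))) \<longlonglongrightarrow> energy p"
    by (rule continuous_on_tendsto_compose[OF continuous_energy[of UNIV] s(3)]) auto
  have ge: "energy p \<le> energy (x t)" if "0 \<le> t" for t
  proof (rule tendsto_upperbound[OF Es])
    have "\<forall>\<^sub>F m in sequentially. t \<le> s m"
      using s(2) by (simp add: filterlim_at_top)
    then show "\<forall>\<^sub>F m in sequentially. energy (x (s m)) \<le> energy (x t)"
      by eventually_elim (use energy_decreasing that in blast)
  qed simp
  show ?thesis
  proof (rule order_tendstoI)
    fix a assume "a < energy p"
    show "\<forall>\<^sub>F t in at_top. a < energy (x t)"
      using eventually_ge_at_top[of 0] by eventually_elim (use ge \<open>a < energy p\<close> in force)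
  next
    fix a assume "energy p < a"
    then have "\<forall>\<^sub>F m in sequentially. energy (x (s m)) < a"
      using Es by (intro order_tendstoD)
    then obtain m where m: "energy (x (s m)) < a"
      by (meson eventually_happens' sequentially_bot)
    show "\<forall>\<^sub>F t in at_top. energy (x t) < a"
      using eventually_ge_at_top[of "s m"]
      by eventually_elim (use m s(1) energy_decreasing in force)
  qed
qed

section \<open>Accumulation points\<close>

lemma first_exit:
  assumes "0 \<le> s" "s \<le> t" "norm (x s - p) < r" "r \<le> norm (x t - p)"
  obtains u where "s \<le> u" "norm (x u - p) = r" "\<And>v. v \<in> {s..u} \<Longrightarrow> norm (x v - p) \<le> r"
proof -
  let ?S = "{v \<in> {s..t}. r \<le> norm (x v - p)}"
  have cont: "continuous_on {s..t} (\<lambda>v. norm (x v - p))"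
    using assms(1) by (intro continuous_intros continuous_on_subset[OF continuous_x]) auto
  have "closed ?S"
    using continuous_closed_preimage[OF cont, of "{r..}"] by (simp add: vimage_def Int_def conj_commute)
  moreover have "t \<in> ?S" using assms by simp
  moreover have bdd: "bdd_below ?S" by (rule bdd_belowI[of _ s]) auto
  ultimately have Inf: "Inf ?S \<in> ?S" by (intro closed_contains_Inf) auto
  define u where "u = Inf ?S"
  from Inf have u: "s \<le> u" "u \<le> t" "r \<le> norm (x u - p)"
    unfolding u_def[symmetric] by auto
  have before: "norm (x v - p) < r" if "s \<le> v" "v < u" for v
  proof (rule ccontr)
    assume "\<not> norm (x v - p) < r"
    then have "v \<in> ?S" using that u(2) by simp
    then have "u \<le> v" unfolding u_def by (rule cInf_lower[OF _ bdd])
    then show False using that(2) by simp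
  qed
  have "continuous_on {s..u} (\<lambda>v. norm (x v - p))"
    by (rule continuous_on_subset[OF cont]) (use u(2) in auto)
  then obtain v where v: "s \<le> v" "v \<le> u" "norm (x v - p) = r"
    using IVT'[of "\<lambda>v. norm (x v - p)" s r u] assms(3) u(1,3) by auto
  then have "v = u" using before[of v] by force
  then show ?thesis
    using u(1) v(3) before by (intro that[of u]) (auto simp: le_less)
qed

text \<open>
  Suppose the trajectory keeps leaving a small ball around \<open>p\<close> on which \<open>(A x)\<^sub>i\<close> stays away from zero
  for all \<open>i\<close> with \<open>(A p)\<^sub>i \<noteq> 0\<close>. Each excursion from near \<open>p\<close> to the sphere costs a vanishing amount of
  energy, so these components do not move in the limit. A limit \<open>y\<close> of the exit points then satisfies
  \<open>(y - p) \<bullet> A p = 0\<close> and has the same energy as \<open>p\<close>, so \<open>y - p\<close> is an isotropic vector and lies in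
  the kernel. The assumption \<open>rigid\<close> gives \<open>y = p\<close>, although \<open>y\<close> lies on the sphere.
\<close>

lemma tendsto_accumulation_point:
  assumes acc: "accumulation_point_at_top x p"
    and rigid: "\<And>d. d \<in> matrix_kernel A \<Longrightarrow> (\<And>i. (A *v p) $ i \<noteq> 0 \<Longrightarrow> d $ i = 0) \<Longrightarrow> d = 0"
  shows "(x \<longlongrightarrow> p) at_top"
proof (rule ccontr)
  assume not_lim: "\<not> (x \<longlongrightarrow> p) at_top"
  define I where "I = {i. (A *v p) $ i \<noteq> 0}"
  obtain c where c: "0 < c" "\<And>i. i \<in> I \<Longrightarrow> c < \<bar>(A *v p) $ i\<bar>"
  proof -
    define c where "c = Min (insert 1 ((\<lambda>i. \<bar>(A *v p) $ i\<bar>) ` I)) / 2"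
    have pos: "0 < Min (insert 1 ((\<lambda>i. \<bar>(A *v p) $ i\<bar>) ` I))"
      by (subst Min_gr_iff) (auto simp: I_def)
    show ?thesis
    proof (rule that[of c])
      show "0 < c" using pos by (simp add: c_def)
      show "c < \<bar>(A *v p) $ i\<bar>" if "i \<in> I" for i
      proof -
        have "Min (insert 1 ((\<lambda>i. \<bar>(A *v p) $ i\<bar>) ` I)) \<le> \<bar>(A *v p) $ i\<bar>"
          using that by (intro Min_le) auto
        then show ?thesis using pos unfolding c_def by linarith
      qed
    qed
  qed
  have "\<forall>\<^sub>F y in nhds p. \<forall>i\<in>I. c < \<bar>(A *v y) $ i\<bar>"
  proof (intro eventually_ball_finite ballI)
    fix i assume "i \<in> I"
    have "((\<lambda>y. \<bar>(A *v y) $ i\<bar>) \<longlongrightarrow> \<bar>(A *v p) $ i\<bar>) (nhds p)"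
      by (intro tendsto_intros bounded_linear.tendsto[OF matrix_vector_mul_bounded_linear] filterlim_ident)
    then show "\<forall>\<^sub>F y in nhds p. c < \<bar>(A *v y) $ i\<bar>"
      using c(2)[OF \<open>i \<in> I\<close>] by (rule order_tendstoD)
  qed simp
  then obtain \<rho> where \<rho>: "0 < \<rho>" "\<And>y i. dist y p < \<rho> \<Longrightarrow> i \<in> I \<Longrightarrow> c < \<bar>(A *v y) $ i\<bar>"
    by (auto simp: eventually_nhds_metric)
  obtain \<epsilon> where \<epsilon>: "0 < \<epsilon>" "\<not> (\<forall>\<^sub>F t in at_top. dist (x t) p < \<epsilon>)"
    using not_lim by (auto simp: tendsto_iff)
  define r where "r = min \<epsilon> (\<rho> / 2)"
  have r: "0 < r" "r < \<rho>" "r \<le> \<epsilon>" using \<rho>(1) \<epsilon>(1) by (auto simp: r_def)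
  have far: "\<exists>t\<ge>s. r \<le> norm (x t - p)" for s
    using \<epsilon>(2) r(3) by (force simp: eventually_at_top_linorder dist_norm not_less)
  obtain s :: "nat \<Rightarrow> real" where s: "\<And>m. 0 \<le> s m" "filterlim s at_top sequentially"
    "(\<lambda>m. x (s m)) \<longlonglongrightarrow> p"
    using acc by (auto simp: accumulation_point_at_top_def)
  have "\<forall>\<^sub>F m in sequentially. dist (x (s m)) p < r"
    using s(3) r(1) by (simp add: tendsto_iff)
  then obtain m\<^sub>0 where m\<^sub>0: "\<And>m. m\<^sub>0 \<le> m \<Longrightarrow> norm (x (s m) - p) < r"
    by (auto simp: eventually_sequentially dist_norm)
  \<comment> \<open>Drop the initial members of the sequence, at which the trajectory need not be close to \<open>p\<close>.\<close>
  define \<sigma> where "\<sigma> m = s (m + m\<^sub>0)" for m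
  have \<sigma>: "0 \<le> \<sigma> m" "norm (x (\<sigma> m) - p) < r" for m
    using s(1) m\<^sub>0 by (auto simp: \<sigma>_def)
  have \<sigma>_top: "filterlim \<sigma> at_top sequentially"
    using filterlim_compose[OF s(2) filterlim_add_const_nat_at_top[of m\<^sub>0]] by (simp add: \<sigma>_def[abs_def])
  have \<sigma>_lim: "(\<lambda>m. x (\<sigma> m)) \<longlonglongrightarrow> p"
    using LIMSEQ_ignore_initial_segment[OF s(3), of m\<^sub>0] by (simp add: \<sigma>_def)
  have "\<exists>u\<ge>\<sigma> m. norm (x u - p) = r \<and> (\<forall>v\<in>{\<sigma> m..u}. norm (x v - p) \<le> r)" for m
    using far[of "\<sigma> m"] first_exit[of "\<sigma> m" _ p r] \<sigma>[of m] by metis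
  then obtain \<tau> where \<tau>: "\<And>m. \<sigma> m \<le> \<tau> m" "\<And>m. norm (x (\<tau> m) - p) = r"
    "\<And>m v. v \<in> {\<sigma> m..\<tau> m} \<Longrightarrow> norm (x v - p) \<le> r"
    by metis
  have "compact (sphere p r)" by simp
  moreover have "\<forall>m. x (\<tau> m) \<in> sphere p r"
    using \<tau>(2) by (simp add: dist_norm norm_minus_commute)
  ultimately obtain y and k :: "nat \<Rightarrow> nat" where y: "y \<in> sphere p r" and k: "strict_mono k"
    and lim_y: "((\<lambda>m. x (\<tau> m)) \<circ> k) \<longlonglongrightarrow> y"
    unfolding compact_def by metis
  define d where "d = y - p"
  have \<tau>_top: "filterlim \<tau> at_top sequentially"
    using \<sigma>_top by (rule filterlim_at_top_mono) (simp add: \<tau>(1))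
  have E: "(\<lambda>m. energy (x (\<sigma> m))) \<longlonglongrightarrow> energy p" "(\<lambda>m. energy (x (\<tau> m))) \<longlonglongrightarrow> energy p"
    using filterlim_compose[OF energy_tendsto_accumulation[OF acc]] \<sigma>_top \<tau>_top by blast+
  have dI: "d $ i = 0" if i: "i \<in> I" for i
  proof -
    have "c * \<bar>x (\<tau> m) $ i - x (\<sigma> m) $ i\<bar> \<le> energy (x (\<sigma> m)) - energy (x (\<tau> m))" for m
    proof (rule displacement_le_energy_loss)
      fix u assume "u \<in> {\<sigma> m..\<tau> m}"
      then show "c \<le> \<bar>(A *v x u) $ i\<bar>"
        using \<rho>(2)[of "x u" i] \<tau>(3)[of u m] r(2) i by (simp add: dist_norm)
    qed (use \<sigma> \<tau> c in auto)
    then have bound: "norm (x (\<tau> m) $ i - x (\<sigma> m) $ i)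
        \<le> (energy (x (\<sigma> m)) - energy (x (\<tau> m))) / c" for m
      using c(1) by (simp add: pos_le_divide_eq mult.commute)
    have "(\<lambda>m. (energy (x (\<sigma> m)) - energy (x (\<tau> m))) / c) \<longlonglongrightarrow> (energy p - energy p) / c"
      using c(1) by (intro tendsto_divide tendsto_diff E tendsto_const) simp
    then have "(\<lambda>m. (energy (x (\<sigma> m)) - energy (x (\<tau> m))) / c) \<longlonglongrightarrow> 0"
      by (simp only: diff_self div_0)
    then have "(\<lambda>m. x (\<tau> m) $ i - x (\<sigma> m) $ i) \<longlonglongrightarrow> 0"
      by (rule Lim_null_comparison[OF always_eventually[OF allI[OF bound]]])
    from LIMSEQ_subseq_LIMSEQ[OF this k]
    have "(\<lambda>m. x (\<tau> (k m)) $ i - x (\<sigma> (k m)) $ i) \<longlonglongrightarrow> 0"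
      by (simp add: o_def)
    moreover have "(\<lambda>m. x (\<sigma> (k m))) \<longlonglongrightarrow> p"
      using LIMSEQ_subseq_LIMSEQ[OF \<sigma>_lim k] by (simp add: o_def)
    then have "(\<lambda>m. x (\<tau> (k m)) $ i - x (\<sigma> (k m)) $ i) \<longlonglongrightarrow> y $ i - p $ i"
      using lim_y by (intro tendsto_intros) (simp_all add: o_def)
    ultimately have "0 = y $ i - p $ i" by (rule LIMSEQ_unique)
    then show ?thesis by (simp add: d_def)
  qed
  have "(\<lambda>m. energy (x (\<tau> (k m)))) \<longlonglongrightarrow> energy y"
    using lim_y by (intro continuous_on_tendsto_compose[OF continuous_energy[of UNIV]]) (auto simp: o_def)
  moreover have "(\<lambda>m. energy (x (\<tau> (k m)))) \<longlonglongrightarrow> energy p"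
    using LIMSEQ_subseq_LIMSEQ[OF E(2) k] by (simp add: o_def)
  ultimately have "energy y = energy p" by (rule LIMSEQ_unique)
  moreover have "d \<bullet> (A *v p) = 0"
    unfolding inner_vec_def using dI by (intro sum.neutral) (auto simp: I_def)
  ultimately have "d \<bullet> (A *v d) = 0"
    using energy_add[of p d] by (simp add: d_def)
  then have "d \<in> matrix_kernel A"
    using pos_semidef_isotropic_in_kernel[OF psd] by (simp add: matrix_kernel_def)
  then have "d = 0"
    using dI by (intro rigid) (auto simp: I_def)
  then show False using y r(1) by (simp add: d_def)
qed

text \<open>
  A positive definite energy is bounded below by a multiple of the squared norm, so its decay keeps
  the trajectory bounded.
\<close>

lemma pos_def_accumulation_point:
  assumes pd: "pos_def_matrix A"
  obtains p where "accumulation_point_at_top x p"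
proof -
  obtain \<mu> where \<mu>: "0 < \<mu>" "\<And>v. \<mu> * (norm v)\<^sup>2 \<le> energy v"
  proof -
    obtain w :: "real^'n" where w: "w \<in> sphere 0 1" "\<And>v. v \<in> sphere 0 1 \<Longrightarrow> energy w \<le> energy v"
      using continuous_attains_inf[of "sphere 0 1" energy] continuous_energy by auto
    have "w \<noteq> 0" using w(1) by auto
    then have "0 < energy w"
      using pd by (auto simp: pos_def_matrix_def energy_def)
    moreover have "energy w * (norm v)\<^sup>2 \<le> energy v" for v
    proof (cases "v = 0")
      case True
      then show ?thesis by (simp add: energy_def)
    next
      case False
      have "energy w \<le> energy (v /\<^sub>R norm v)" using False by (intro w(2)) simp
      also have "\<dots> = energy v / (norm v)\<^sup>2"
        by (simp add: energy_def matrix_vector_mult_scaleR power2_eq_square divide_simps)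
      finally show ?thesis using False by (simp add: field_simps)
    qed
    ultimately show ?thesis by (rule that)
  qed
  define R where "R = sqrt (energy (x 0) / \<mu>)"
  have "norm (x t) \<le> R" if "0 \<le> t" for t
  proof -
    have "\<mu> * (norm (x t))\<^sup>2 \<le> energy (x 0)"
      using \<mu>(2)[of "x t"] energy_decreasing[of 0 t] that by simp
    then show ?thesis
      using \<mu>(1) by (intro real_le_rsqrt[of "norm (x t)" "energy (x 0) / \<mu>", folded R_def]) (simp add: field_simps)
  qed
  then have "\<forall>m. x (real m) \<in> cball 0 R" by simp
  then obtain p and k :: "nat \<Rightarrow> nat" where k: "strict_mono k" "((\<lambda>m. x (real m)) \<circ> k) \<longlonglongrightarrow> p"
    using compact_cball[of "0 :: real^'n" R] unfolding compact_def by metis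
  have "filterlim (\<lambda>m. real (k m)) at_top sequentially"
    using filterlim_compose[OF filterlim_real_sequentially filterlim_subseq[OF k(1)]] .
  then show ?thesis
    using k(2) by (intro that[of p]) (auto simp: accumulation_point_at_top_def o_def intro!: exI[of _ "\<lambda>m. real (k m)"])
qed

end

theorem theorem1:
  fixes A :: "real^'n^'n" and x :: "real \<Rightarrow> real^'n"
  assumes "pos_semidef_matrix A"
    and "locally_absolutely_continuous_fun_on {0..} x"
    and "\<And>i. AE t in lebesgue_on {0..}.
           vector_derivative x (at t within {0..}) $ i * (row i A \<bullet> x t) \<le> 0"
  shows "(pos_def_matrix A \<longrightarrow> (\<exists>xstar. (x \<longlongrightarrow> xstar) at_top)) \<and>
         ((\<forall>w \<in> matrix_kernel A. w \<noteq> 0 \<longrightarrow> (\<forall>i. w $ i \<noteq> 0)) \<longrightarrow>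
            (\<exists>xstar. (x \<longlongrightarrow> xstar) at_top) \<or>
            (\<forall>xbar. accumulation_point_at_top x xbar \<longrightarrow> xbar \<in> matrix_kernel A))"
proof -
  interpret opposing_drift A x
    by unfold_locales (fact assms)+
  show ?thesis
  proof (intro conjI impI)
    assume pd: "pos_def_matrix A"
    then obtain p where p: "accumulation_point_at_top x p"
      by (rule pos_def_accumulation_point)
    have "d = 0" if "d \<in> matrix_kernel A" for d
      using pd that by (force simp: pos_def_matrix_def matrix_kernel_def)
    then show "\<exists>xstar. (x \<longlongrightarrow> xstar) at_top"
      using tendsto_accumulation_point[OF p] by blast
  next
    assume full: "\<forall>w \<in> matrix_kernel A. w \<noteq> 0 \<longrightarrow> (\<forall>i. w $ i \<noteq> 0)"
    show "(\<exists>xstar. (x \<longlongrightarrow> xstar) at_top) \<or>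
        (\<forall>xbar. accumulation_point_at_top x xbar \<longrightarrow> xbar \<in> matrix_kernel A)"
    proof (rule disjCI)
      assume "\<not> (\<forall>xbar. accumulation_point_at_top x xbar \<longrightarrow> xbar \<in> matrix_kernel A)"
      then obtain p i where p: "accumulation_point_at_top x p" "(A *v p) $ i \<noteq> 0"
        by (auto simp: matrix_kernel_def vec_eq_iff)
      then have "(x \<longlongrightarrow> p) at_top"
        using full by (intro tendsto_accumulation_point) auto
      then show "\<exists>xstar. (x \<longlongrightarrow> xstar) at_top" by blast
    qed
  qed
qed

end
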